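(* Let $Q=\overline{U}_{\mathrm i}s\ell(2)$ be the 16-dimensional restricted quantum group at $\mathfrak q=\mathrm i$, regarded as a Hopf algebra over $\mathbb C$. The monoidal category $\mathbf{Rep}\,Q$ of finite-dimensional representations of $Q$ (with tensor product given by the coproduct and trivial associator) is not braidable, i.e. it admits no braiding. Equivalently, $Q$ has no universal R-matrix.
   Context: $Q=\overline{U}_{\mathrm i}s\ell(2)$ is the associative unital $\mathbb C$-algebra with generators $E,F,K^{\pm1}$ and relations $KEK^{-1}=-E$, $KFK^{-1}=-F$, $[E,F]=\frac{K-K^{-1}}{2\mathrm i}$, $E^2=F^2=0$, $K^4=1$; it has dimension 16. It is a Hopf algebra with $\Delta(E)=1\otimes E+E\otimes K$, $\Delta(F)=K^{-1}\otimes F+F\otimes 1$, $\Delta(K)=K\otimes K$, $\epsilon(E)=\epsilon(F)=0$, $\epsilon(K)=1$, $S(E)=-EK^{-1}$, $S(F)=-KF$, $S(K)=K^{-1}$. A universal R-matrix for a Hopf algebra $A$ is an invertible element $R\in A\otimes A$ such that $R\Delta(a)=\Delta^{\mathrm{op}}(a)R$ for all $a\in A$, $(\Delta\otimes\mathrm{id})(R)=R_{13}R_{23}$ and $(\mathrm{id}\otimes\Delta)(R)=R_{13}R_{12}$. *)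

theory Defs
  imports Complex_Main "HOL-Library.Multiset" "HOL-Library.Poly_Mapping" "Jordan_Normal_Form.Matrix"
begin

section \<open>Complex vector spaces and algebras\<close>

class complex_space = ab_group_add +
  fixes scaleC :: "complex \<Rightarrow> 'a \<Rightarrow> 'a" (infixr "*\<^sub>C" 75)
  assumes scaleC_add_right: "c *\<^sub>C (x + y) = c *\<^sub>C x + c *\<^sub>C y"
    and scaleC_add_left: "(c + d) *\<^sub>C x = c *\<^sub>C x + d *\<^sub>C x"
    and scaleC_scaleC: "c *\<^sub>C d *\<^sub>C x = (c * d) *\<^sub>C x"
    and scaleC_one [simp]: "1 *\<^sub>C x = x"
begin

lemma scaleC_zero_right [simp]: "c *\<^sub>C 0 = 0"
  using scaleC_add_right[of c 0 0] by simp

lemma scaleC_zero_left [simp]: "0 *\<^sub>C x = 0"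
  using scaleC_add_left[of 0 0 x] by simp

lemma scaleC_minus_left: "(- c) *\<^sub>C x = - (c *\<^sub>C x)"
  using scaleC_add_left[of "- c" c x] by (simp add: eq_neg_iff_add_eq_0)

lemma scaleC_minus_right: "c *\<^sub>C (- x) = - (c *\<^sub>C x)"
  using scaleC_add_right[of c "- x" x] by (simp add: eq_neg_iff_add_eq_0)

lemma scaleC_diff_right: "c *\<^sub>C (x - y) = c *\<^sub>C x - c *\<^sub>C y"
  using scaleC_add_right[of c x "- y"] by (simp add: scaleC_minus_right)

lemma scaleC_sum_right: "c *\<^sub>C sum f A = (\<Sum>x\<in>A. c *\<^sub>C f x)"
  by (induction A rule: infinite_finite_induct) (auto simp: scaleC_add_right)

end

text \<open>Based on \<^class>\<open>ring\<close> and \<^class>\<open>monoid_mult\<close> rather than \<^class>\<open>ring_1\<close>, since the latter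
  assumes \<open>0 \<noteq> 1\<close>.\<close>

class complex_algebra = complex_space + ring + monoid_mult +
  assumes mult_scaleC_left: "(c *\<^sub>C x) * y = c *\<^sub>C (x * y)"
    and mult_scaleC_right: "x * (c *\<^sub>C y) = c *\<^sub>C (x * y)"

instantiation complex :: complex_algebra
begin
definition scaleC_complex :: "complex \<Rightarrow> complex \<Rightarrow> complex" where "scaleC_complex c x = c * x"
instance by standard (auto simp: scaleC_complex_def algebra_simps)
end

definition clinear_map :: "('a::complex_space \<Rightarrow> 'b::complex_space) \<Rightarrow> bool" where
  "clinear_map f \<longleftrightarrow> (\<forall>x y. f (x + y) = f x + f y) \<and> (\<forall>c x. f (c *\<^sub>C x) = c *\<^sub>C f x)"

definition algebra_map :: "('a::complex_algebra \<Rightarrow> 'b::complex_algebra) \<Rightarrow> bool" where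
  "algebra_map f \<longleftrightarrow> clinear_map f \<and> f 1 = 1 \<and> (\<forall>x y. f (x * y) = f x * f y)"


section \<open>The algebraic tensor product\<close>

text \<open>An element of \<open>A \<otimes> B\<close> is a finite formal sum of pairs, represented as a multiset with
  multiset union as addition, modulo the congruence generated by bilinearity.\<close>

inductive tensor_rel ::
  "('a::complex_space \<times> 'b::complex_space) multiset \<Rightarrow> ('a \<times> 'b) multiset \<Rightarrow> bool" where
  refl: "tensor_rel M M"
| sym: "tensor_rel M N \<Longrightarrow> tensor_rel N M"
| trans: "tensor_rel M N \<Longrightarrow> tensor_rel N P \<Longrightarrow> tensor_rel M P"
| union: "tensor_rel M M' \<Longrightarrow> tensor_rel N N' \<Longrightarrow> tensor_rel (M + N) (M' + N')"
| zero: "tensor_rel {#(0, b)#} {#}"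
| add_left: "tensor_rel {#(a + a', b)#} {#(a, b), (a', b)#}"
| add_right: "tensor_rel {#(a, b + b')#} {#(a, b), (a, b')#}"
| scale: "tensor_rel {#(c *\<^sub>C a, b)#} {#(a, c *\<^sub>C b)#}"

quotient_type (overloaded) ('a, 'b) tensor =
  "('a::complex_space \<times> 'b::complex_space) multiset" / tensor_rel
  by (rule equivpI) (auto simp: reflp_def symp_def transp_def intro: tensor_rel.intros)

lift_definition tens :: "'a::complex_space \<Rightarrow> 'b::complex_space \<Rightarrow> ('a, 'b) tensor"
  (infixr "\<otimes>\<^sub>t" 72) is "\<lambda>a b. {#(a, b)#}" .

definition bilinear_map ::
  "('a::complex_space \<Rightarrow> 'b::complex_space \<Rightarrow> 'c::complex_space) \<Rightarrow> bool" where
  "bilinear_map f \<longleftrightarrow> (\<forall>a. clinear_map (f a)) \<and> (\<forall>b. clinear_map (\<lambda>a. f a b))"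

text \<open>The linear map on \<open>A \<otimes> B\<close> induced by \<open>f\<close>; it is independent of the chosen representative
  when \<open>f\<close> is bilinear, and is only used for such \<open>f\<close>.\<close>

definition tensor_lift ::
  "('a::complex_space \<Rightarrow> 'b::complex_space \<Rightarrow> 'c::complex_space) \<Rightarrow> ('a, 'b) tensor \<Rightarrow> 'c" where
  "tensor_lift f t = (\<Sum>p\<in>#rep_tensor t. f (fst p) (snd p))"

lemma bilinear_mapD:
  assumes "bilinear_map f"
  shows "f (a + a') b = f a b + f a' b" "f a (b + b') = f a b + f a b'"
    "f (c *\<^sub>C a) b = c *\<^sub>C f a b" "f a (c *\<^sub>C b) = c *\<^sub>C f a b" "f 0 b = 0" "f a 0 = 0"
proof -
  show 1: "f (a + a') b = f a b + f a' b" "f a (b + b') = f a b + f a b'"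
    "f (c *\<^sub>C a) b = c *\<^sub>C f a b" "f a (c *\<^sub>C b) = c *\<^sub>C f a b" for a b a' b' c
    using assms by (auto simp: bilinear_map_def clinear_map_def)
  show "f 0 b = 0" using 1(3)[of 0 0 b] by simp
  show "f a 0 = 0" using 1(4)[of a 0 0] by simp
qed

lemma bilinear_mapI:
  assumes "\<And>a a' b. f (a + a') b = f a b + f a' b" "\<And>a b b'. f a (b + b') = f a b + f a b'"
    "\<And>c a b. f (c *\<^sub>C a) b = c *\<^sub>C f a b" "\<And>c a b. f a (c *\<^sub>C b) = c *\<^sub>C f a b"
  shows "bilinear_map f"
  using assms by (auto simp: bilinear_map_def clinear_map_def)

lemma tensor_rel_sum:
  assumes "bilinear_map f" "tensor_rel M N"
  shows "(\<Sum>p\<in>#M. f (fst p) (snd p)) = (\<Sum>p\<in>#N. f (fst p) (snd p))"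
  using assms(2) by induction (auto simp: bilinear_mapD[OF assms(1)] add_ac)

lemma tensor_abs_cases: "\<exists>M. t = abs_tensor M"
  by (induction t rule: tensor.abs_induct) blast

lemma tensor_lift_abs:
  assumes "bilinear_map f"
  shows "tensor_lift f (abs_tensor M) = (\<Sum>p\<in>#M. f (fst p) (snd p))"
  unfolding tensor_lift_def
  by (rule tensor_rel_sum[OF assms])
    (simp add: Quotient3_abs_rep[OF Quotient3_tensor] flip: tensor.abs_eq_iff)

instantiation tensor :: (complex_space, complex_space) ab_group_add
begin

lift_definition zero_tensor :: "('a, 'b) tensor" is "{#}" .

lift_definition plus_tensor :: "('a, 'b) tensor \<Rightarrow> ('a, 'b) tensor \<Rightarrow> ('a, 'b) tensor" is "(+)"
  by (rule tensor_rel.union)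

lemma tensor_rel_scale_left:
  assumes "tensor_rel M N"
  shows "tensor_rel (image_mset (map_prod ((*\<^sub>C) c) id) M) (image_mset (map_prod ((*\<^sub>C) c) id) N)"
  using assms
proof induction
  case (sym M N) then show ?case by (blast intro: tensor_rel.sym)
next
  case (trans M N P) then show ?case by (blast intro: tensor_rel.trans)
next
  case (add_left a a' b)
  then show ?case using tensor_rel.add_left[of "c *\<^sub>C a" "c *\<^sub>C a'" b] by (simp add: scaleC_add_right)
next
  case (scale d a b)
  then show ?case using tensor_rel.scale[of d "c *\<^sub>C a" b] by (simp add: scaleC_scaleC mult.commute)
qed (auto intro: tensor_rel.intros)

lift_definition uminus_tensor :: "('a, 'b) tensor \<Rightarrow> ('a, 'b) tensor"
  is "image_mset (map_prod ((*\<^sub>C) (- 1)) id)"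
  by (rule tensor_rel_scale_left)

definition minus_tensor :: "('a, 'b) tensor \<Rightarrow> ('a, 'b) tensor \<Rightarrow> ('a, 'b) tensor"
  where "minus_tensor s t = s + - t"

instance
proof
  fix a b c :: "('a, 'b) tensor"
  show "a + b + c = a + (b + c)" by transfer (simp add: add_ac tensor_rel.refl)
  show "a + b = b + a" by transfer (simp add: add_ac tensor_rel.refl)
  show "0 + a = a" by transfer (simp add: tensor_rel.refl)
  show "a - b = a + - b" by (simp add: minus_tensor_def)
  show "- a + a = 0"
  proof transfer
    fix M :: "('a \<times> 'b) multiset"
    show "tensor_rel (image_mset (map_prod ((*\<^sub>C) (- 1)) id) M + M) {#}"
    proof (induction M)
      case empty
      then show ?case by (simp add: tensor_rel.refl)
    next
      case (add p M)
      obtain a b where p: "p = (a, b)" by force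
      have "tensor_rel {#((- 1) *\<^sub>C a, b), (a, b)#} {#((- 1) *\<^sub>C a + a, b)#}"
        by (rule tensor_rel.sym, rule tensor_rel.add_left)
      also have "(- 1) *\<^sub>C a + a = 0" by (simp add: scaleC_minus_left scaleC_one)
      finally have "tensor_rel {#((- 1) *\<^sub>C a, b), (a, b)#} {#}"
        using tensor_rel.zero tensor_rel.trans by blast
      from tensor_rel.union[OF this add]
      show ?case by (simp add: p add_ac)
    qed
  qed
qed

end

lemma tensor_lift_tens [simp]: "bilinear_map f \<Longrightarrow> tensor_lift f (a \<otimes>\<^sub>t b) = f a b"
  by (simp add: tens.abs_eq tensor_lift_abs)

lemma tensor_lift_add [simp]:
  assumes "bilinear_map f"
  shows "tensor_lift f (s + t) = tensor_lift f s + tensor_lift f t"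
proof -
  obtain M N where "s = abs_tensor M" "t = abs_tensor N" using tensor_abs_cases by metis
  then show ?thesis using assms by (simp add: tensor_lift_abs plus_tensor.abs_eq)
qed

lemma tensor_lift_zero [simp]: "bilinear_map f \<Longrightarrow> tensor_lift f 0 = 0"
  by (simp add: zero_tensor.abs_eq tensor_lift_abs)

lemma tensor_induct [case_names zero tens add]:
  assumes "P 0" "\<And>a b. P (a \<otimes>\<^sub>t b)" "\<And>s t. P s \<Longrightarrow> P t \<Longrightarrow> P (s + t)"
  shows "P t"
proof -
  obtain M where t: "t = abs_tensor M" using tensor_abs_cases by metis
  have "P (abs_tensor M)"
  proof (induction M)
    case empty
    then show ?case using assms(1) by (simp add: zero_tensor.abs_eq)
  next
    case (add p M)
    have "abs_tensor (add_mset p M) = fst p \<otimes>\<^sub>t snd p + abs_tensor M"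
      by (simp add: tens.abs_eq plus_tensor.abs_eq)
    then show ?case using assms(2,3) add by simp
  qed
  then show ?thesis using t by simp
qed

lemma tens_add_left: "(a + a') \<otimes>\<^sub>t b = a \<otimes>\<^sub>t b + a' \<otimes>\<^sub>t b"
  using tensor_rel.add_left[of a a' b] by (simp add: tens.abs_eq plus_tensor.abs_eq tensor.abs_eq_iff add_mset_commute)

lemma tens_add_right: "a \<otimes>\<^sub>t (b + b') = a \<otimes>\<^sub>t b + a \<otimes>\<^sub>t b'"
  using tensor_rel.add_right[of a b b'] by (simp add: tens.abs_eq plus_tensor.abs_eq tensor.abs_eq_iff add_mset_commute)

instantiation tensor :: (complex_space, complex_space) complex_space
begin

lift_definition scaleC_tensor :: "complex \<Rightarrow> ('a, 'b) tensor \<Rightarrow> ('a, 'b) tensor"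
  is "\<lambda>c. image_mset (map_prod ((*\<^sub>C) c) id)"
  by (rule tensor_rel_scale_left)

lemma scaleC_tens_left: "c *\<^sub>C (a \<otimes>\<^sub>t b) = (c *\<^sub>C a) \<otimes>\<^sub>t b"
  by transfer (simp add: tensor_rel.refl)

lemma scaleC_tensor_add: "c *\<^sub>C (s + t) = c *\<^sub>C s + c *\<^sub>C (t :: ('a, 'b) tensor)"
  by transfer (simp add: tensor_rel.refl)

lemma scaleC_tensor_zero: "c *\<^sub>C (0 :: ('a, 'b) tensor) = 0"
  by transfer (simp add: tensor_rel.refl)

instance
proof
  fix c d :: complex and x y :: "('a, 'b) tensor"
  show "c *\<^sub>C (x + y) = c *\<^sub>C x + c *\<^sub>C y" by (rule scaleC_tensor_add)
  show "(c + d) *\<^sub>C x = c *\<^sub>C x + d *\<^sub>C x"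
    by (induction x rule: tensor_induct)
      (auto simp: scaleC_tensor_add scaleC_tensor_zero scaleC_tens_left scaleC_add_left tens_add_left)
  show "c *\<^sub>C d *\<^sub>C x = (c * d) *\<^sub>C x"
    by (induction x rule: tensor_induct)
      (auto simp: scaleC_tensor_add scaleC_tensor_zero scaleC_tens_left scaleC_scaleC)
  show "1 *\<^sub>C x = x"
    by (induction x rule: tensor_induct)
      (auto simp: scaleC_tensor_add scaleC_tensor_zero scaleC_tens_left)
qed

end

lemma scaleC_tens_right: "c *\<^sub>C (a \<otimes>\<^sub>t b) = a \<otimes>\<^sub>t (c *\<^sub>C b)"
  by (subst scaleC_tens_left) (simp add: tens.abs_eq tensor.abs_eq_iff tensor_rel.scale)

lemma bilinear_tens [simp]: "bilinear_map (\<otimes>\<^sub>t)"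
  by (intro bilinear_mapI) (auto simp: tens_add_left tens_add_right scaleC_tens_left[symmetric]
      scaleC_tens_right[symmetric])

lemma clinear_tensor_lift:
  assumes "bilinear_map f"
  shows "clinear_map (tensor_lift f)"
proof -
  have "tensor_lift f (c *\<^sub>C t) = c *\<^sub>C tensor_lift f t" for c t
    by (induction t rule: tensor_induct)
      (auto simp: assms scaleC_tens_left bilinear_mapD[OF assms] scaleC_add_right)
  then show ?thesis by (simp add: clinear_map_def assms)
qed

lemma clinear_mapD:
  assumes "clinear_map f"
  shows "f (x + y) = f x + f y" "f (c *\<^sub>C x) = c *\<^sub>C f x" "f 0 = 0" "f (- x) = - f x" "f (x - y) = f x - f y"
proof -
  show 1: "f (x + y) = f x + f y" "f (c *\<^sub>C x) = c *\<^sub>C f x" for x y c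
    using assms by (auto simp: clinear_map_def)
  show 0: "f 0 = 0" using 1(1)[of 0 0] by simp
  show 2: "f (- x) = - f x" for x using 1(1)[of x "- x"] 0 by (simp add: eq_neg_iff_add_eq_0 add.commute)
  show "f (x - y) = f x - f y" using 1(1)[of x "- y"] 2 by simp
qed

lemma tensor_lift_fun_add: "tensor_lift (\<lambda>a b. f a b + g a b) t = tensor_lift f t + tensor_lift g t"
  by (simp add: tensor_lift_def sum_mset.distrib)

lemma tensor_lift_fun_scaleC: "tensor_lift (\<lambda>a b. c *\<^sub>C f a b) t = c *\<^sub>C tensor_lift f t"
proof -
  have "(\<Sum>p\<in>#M. c *\<^sub>C f (fst p) (snd p)) = c *\<^sub>C (\<Sum>p\<in>#M. f (fst p) (snd p))" for M
    by (induction M) (auto simp: scaleC_add_right)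
  then show ?thesis by (simp add: tensor_lift_def)
qed

lemma clinear_eq_tensor:
  assumes "clinear_map f" "clinear_map g" "\<And>a b. f (a \<otimes>\<^sub>t b) = g (a \<otimes>\<^sub>t b)"
  shows "f t = g t"
  by (induction t rule: tensor_induct) (auto simp: assms(3) clinear_mapD[OF assms(1)] clinear_mapD[OF assms(2)])

lemma clinear_map_bilinear:
  assumes "clinear_map f" "bilinear_map g"
  shows "bilinear_map (\<lambda>a b. f (g a b))"
  by (intro bilinear_mapI) (simp_all add: clinear_mapD[OF assms(1)] bilinear_mapD[OF assms(2)])

lemma bilinear_map_clinear:
  assumes "bilinear_map g" "clinear_map f" "clinear_map h"
  shows "bilinear_map (\<lambda>a b. g (f a) (h b))"
  by (intro bilinear_mapI)
    (simp_all add: clinear_mapD[OF assms(2)] clinear_mapD[OF assms(3)] bilinear_mapD[OF assms(1)])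

instantiation tensor :: (complex_algebra, complex_algebra) complex_algebra
begin

definition one_tensor :: "('a, 'b) tensor" where "1 = 1 \<otimes>\<^sub>t 1"

definition times_tensor :: "('a, 'b) tensor \<Rightarrow> ('a, 'b) tensor \<Rightarrow> ('a, 'b) tensor" where
  "s * t = tensor_lift (\<lambda>a b. tensor_lift (\<lambda>c d. (a * c) \<otimes>\<^sub>t (b * d)) t) s"

lemma bilinear_times_aux: "bilinear_map (\<lambda>c d. (a * c) \<otimes>\<^sub>t (b * d) :: ('a, 'b) tensor)"
  by (intro bilinear_mapI) (auto simp: distrib_left tens_add_left tens_add_right
      scaleC_tens_left scaleC_tens_right[symmetric] mult_scaleC_right)

lemma bilinear_times_aux': "bilinear_map (\<lambda>a b. (a * c) \<otimes>\<^sub>t (b * d) :: ('a, 'b) tensor)"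
  by (intro bilinear_mapI) (auto simp: distrib_right tens_add_left tens_add_right
      scaleC_tens_left scaleC_tens_right[symmetric] mult_scaleC_left)

lemma bilinear_times_aux2:
  "bilinear_map (\<lambda>a b. tensor_lift (\<lambda>c d. (a * c) \<otimes>\<^sub>t (b * d)) t :: ('a, 'b) tensor)"
  by (rule bilinear_mapI)
    (simp_all add: distrib_right tens_add_left tens_add_right mult_scaleC_left
      tensor_lift_fun_add tensor_lift_fun_scaleC scaleC_tens_left[symmetric] scaleC_tens_right[symmetric])

lemma tens_mult: "(a \<otimes>\<^sub>t b) * (c \<otimes>\<^sub>t d) = (a * c) \<otimes>\<^sub>t (b * d :: 'b)"
  by (simp add: times_tensor_def bilinear_times_aux bilinear_times_aux')

lemma tensor_distrib:
  fixes s t u :: "('a, 'b) tensor"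
  shows "(s + t) * u = s * u + t * u" "u * (s + t) = u * s + u * t"
    "(c *\<^sub>C s) * u = c *\<^sub>C (s * u)" "u * (c *\<^sub>C s) = c *\<^sub>C (u * s)" "0 * u = 0" "u * 0 = 0"
proof -
  note [simp] = bilinear_times_aux bilinear_times_aux2
  show "(s + t) * u = s * u + t * u" "(c *\<^sub>C s) * u = c *\<^sub>C (s * u)" "0 * u = 0"
    by (auto simp: times_tensor_def clinear_mapD[OF clinear_tensor_lift])
  show "u * (s + t) = u * s + u * t" "u * (c *\<^sub>C s) = c *\<^sub>C (u * s)"
    by (simp_all add: times_tensor_def clinear_mapD[OF clinear_tensor_lift]
        tensor_lift_fun_add tensor_lift_fun_scaleC)
  show "u * 0 = 0"
    by (simp add: times_tensor_def bilinear_times_aux) (simp add: tensor_lift_def)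
qed

instance
proof
  fix a b c :: "('a, 'b) tensor" and k :: complex
  show "(a + b) * c = a * c + b * c" "c * (a + b) = c * a + c * b" by (rule tensor_distrib)+
  show "(k *\<^sub>C a) * b = k *\<^sub>C (a * b)" "a * (k *\<^sub>C b) = k *\<^sub>C (a * b)" by (rule tensor_distrib)+
  show "1 * a = a" "a * 1 = a"
    by (induction a rule: tensor_induct) (auto simp: tensor_distrib one_tensor_def tens_mult)
  show "a * b * c = a * (b * c)"
  proof (induction a rule: tensor_induct)
    case (tens x y)
    show ?case
    proof (induction b rule: tensor_induct)
      case (tens x' y')
      show ?case by (induction c rule: tensor_induct) (auto simp: tensor_distrib tens_mult mult.assoc)
    qed (auto simp: tensor_distrib)
  qed (auto simp: tensor_distrib)
qed

end

lemma algebra_mapD: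
  assumes "algebra_map f"
  shows "f (x + y) = f x + f y" "f (c *\<^sub>C x) = c *\<^sub>C f x" "f 0 = 0" "f (- x) = - f x" "f (x - y) = f x - f y"
    "f 1 = 1" "f (x * y) = f x * f y" "clinear_map f"
  using assms clinear_mapD[of f] by (auto simp: algebra_map_def)

definition tensor_map ::
  "('a::complex_space \<Rightarrow> 'c::complex_space) \<Rightarrow> ('b::complex_space \<Rightarrow> 'd::complex_space) \<Rightarrow>
    ('a, 'b) tensor \<Rightarrow> ('c, 'd) tensor" where
  "tensor_map f g = tensor_lift (\<lambda>a b. f a \<otimes>\<^sub>t g b)"

definition tensor_flip :: "('a::complex_space, 'b::complex_space) tensor \<Rightarrow> ('b, 'a) tensor" where
  "tensor_flip = tensor_lift (\<lambda>a b. b \<otimes>\<^sub>t a)"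

definition tensor_assoc ::
  "(('a::complex_space, 'b::complex_space) tensor, 'c::complex_space) tensor \<Rightarrow> ('a, ('b, 'c) tensor) tensor" where
  "tensor_assoc = tensor_lift (\<lambda>s c. tensor_lift (\<lambda>a b. a \<otimes>\<^sub>t b \<otimes>\<^sub>t c) s)"

lemma bilinear_tensor_map: "clinear_map f \<Longrightarrow> clinear_map g \<Longrightarrow> bilinear_map (\<lambda>a b. f a \<otimes>\<^sub>t g b)"
  by (rule bilinear_map_clinear[OF bilinear_tens])

lemma tensor_map_tens [simp]:
  "clinear_map f \<Longrightarrow> clinear_map g \<Longrightarrow> tensor_map f g (a \<otimes>\<^sub>t b) = f a \<otimes>\<^sub>t g b"
  by (simp add: tensor_map_def bilinear_tensor_map)

lemma clinear_tensor_map [simp]: "clinear_map f \<Longrightarrow> clinear_map g \<Longrightarrow> clinear_map (tensor_map f g)"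
  unfolding tensor_map_def by (intro clinear_tensor_lift bilinear_tensor_map)

lemma bilinear_flip: "bilinear_map (\<lambda>a b. b \<otimes>\<^sub>t a)"
  by (intro bilinear_mapI) (auto simp: tens_add_left tens_add_right scaleC_tens_left[symmetric]
      scaleC_tens_right[symmetric])

lemma tensor_flip_tens [simp]: "tensor_flip (a \<otimes>\<^sub>t b) = b \<otimes>\<^sub>t a"
  by (simp add: tensor_flip_def bilinear_flip)

lemma clinear_tensor_flip [simp]: "clinear_map tensor_flip"
  unfolding tensor_flip_def by (intro clinear_tensor_lift bilinear_flip)

lemma clinear_id [simp]: "clinear_map (\<lambda>x. x)" "clinear_map id"
  by (auto simp: clinear_map_def)

lemma clinear_tens [simp]: "clinear_map (\<lambda>b. a \<otimes>\<^sub>t b)" "clinear_map (\<lambda>a. a \<otimes>\<^sub>t b)"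
  by (auto simp: clinear_map_def tens_add_left tens_add_right scaleC_tens_left scaleC_tens_right[symmetric])

lemma bilinear_assoc_aux: "bilinear_map (\<lambda>a b. a \<otimes>\<^sub>t b \<otimes>\<^sub>t c)"
  by (rule bilinear_map_clinear[OF bilinear_tens, where f = "\<lambda>x. x"]) auto

lemma bilinear_assoc_aux2: "bilinear_map (\<lambda>s c. tensor_lift (\<lambda>a b. a \<otimes>\<^sub>t b \<otimes>\<^sub>t c) s)"
  by (rule bilinear_mapI)
    (simp_all add: clinear_mapD[OF clinear_tensor_lift[OF bilinear_assoc_aux]] tens_add_right
      tensor_lift_fun_add tensor_lift_fun_scaleC scaleC_tens_right[symmetric])

lemma tensor_assoc_tens [simp]: "tensor_assoc ((a \<otimes>\<^sub>t b) \<otimes>\<^sub>t c) = a \<otimes>\<^sub>t b \<otimes>\<^sub>t c"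
  by (simp add: tensor_assoc_def bilinear_assoc_aux bilinear_assoc_aux2)

lemma clinear_tensor_assoc [simp]: "clinear_map tensor_assoc"
  unfolding tensor_assoc_def by (intro clinear_tensor_lift bilinear_assoc_aux2)

lemma clinear_eq_tensor3:
  assumes "clinear_map f" "clinear_map g" "\<And>a b c. f ((a \<otimes>\<^sub>t b) \<otimes>\<^sub>t c) = g ((a \<otimes>\<^sub>t b) \<otimes>\<^sub>t c)"
  shows "f t = g t"
proof (rule clinear_eq_tensor[OF assms(1,2)])
  fix s c show "f (s \<otimes>\<^sub>t c) = g (s \<otimes>\<^sub>t c)"
    by (induction s rule: tensor_induct)
      (auto simp: assms(3) tens_add_left clinear_mapD[OF assms(1)] clinear_mapD[OF assms(2)]
        clinear_mapD(3)[OF clinear_tens(2)])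
qed

lemma algebra_map_tensorI:
  assumes "clinear_map f" "f 1 = 1"
    "\<And>a b c d. f ((a \<otimes>\<^sub>t b) * (c \<otimes>\<^sub>t d)) = f (a \<otimes>\<^sub>t b) * f (c \<otimes>\<^sub>t d)"
  shows "algebra_map f"
proof -
  note [simp] = clinear_mapD[OF assms(1)]
  have "f (s * t) = f s * f t" for s t
  proof (induction s rule: tensor_induct)
    case (tens a b)
    show ?case by (induction t rule: tensor_induct) (auto simp: assms(3) distrib_left)
  qed (auto simp: distrib_right)
  then show ?thesis using assms by (auto simp: algebra_map_def)
qed

lemma algebra_map_tensor_map [simp]:
  assumes "algebra_map f" "algebra_map g"
  shows "algebra_map (tensor_map f g)"
  by (rule algebra_map_tensorI)
    (auto simp: one_tensor_def tens_mult algebra_mapD[OF assms(1)] algebra_mapD[OF assms(2)])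

lemma algebra_map_tensor_assoc [simp]: "algebra_map tensor_assoc"
proof -
  have *: "tensor_assoc ((a \<otimes>\<^sub>t b) * (c \<otimes>\<^sub>t d)) = tensor_assoc (a \<otimes>\<^sub>t b) * tensor_assoc (c \<otimes>\<^sub>t d)"
    for a c :: "('a::complex_algebra, 'b::complex_algebra) tensor" and b d :: "'c::complex_algebra"
  proof (induction a rule: tensor_induct)
    case (tens x y)
    show ?case
      by (induction c rule: tensor_induct)
        (auto simp: tens_mult tens_add_left distrib_left clinear_mapD[OF clinear_tensor_assoc]
          clinear_mapD(3)[OF clinear_tens(2)])
  qed (auto simp: tens_mult tens_add_left distrib_right clinear_mapD[OF clinear_tensor_assoc]
          clinear_mapD(3)[OF clinear_tens(2)])
  show ?thesis by (rule algebra_map_tensorI) (auto simp: * one_tensor_def)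
qed

lemma algebra_map_comp: "algebra_map f \<Longrightarrow> algebra_map g \<Longrightarrow> algebra_map (\<lambda>x. f (g x))"
  by (auto simp: algebra_map_def clinear_map_def)

lemma algebra_map_id [simp]: "algebra_map (\<lambda>x. x)" "algebra_map id"
  by (auto simp: algebra_map_def)


section \<open>Hopf algebras and universal R-matrices\<close>

definition hopf_algebra ::
  "('a::complex_algebra \<Rightarrow> ('a, 'a) tensor) \<Rightarrow> ('a \<Rightarrow> complex) \<Rightarrow> ('a \<Rightarrow> 'a) \<Rightarrow> bool" where
  "hopf_algebra \<Delta> \<epsilon> S \<longleftrightarrow>
     algebra_map \<Delta> \<and> algebra_map \<epsilon> \<and> clinear_map S \<and>
     (\<forall>x. tensor_assoc (tensor_map \<Delta> id (\<Delta> x)) = tensor_map id \<Delta> (\<Delta> x)) \<and>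
     (\<forall>x. tensor_lift (\<lambda>a b. \<epsilon> a *\<^sub>C b) (\<Delta> x) = x) \<and>
     (\<forall>x. tensor_lift (\<lambda>a b. \<epsilon> b *\<^sub>C a) (\<Delta> x) = x) \<and>
     (\<forall>x. tensor_lift (\<lambda>a b. S a * b) (\<Delta> x) = \<epsilon> x *\<^sub>C 1) \<and>
     (\<forall>x. tensor_lift (\<lambda>a b. a * S b) (\<Delta> x) = \<epsilon> x *\<^sub>C 1)"

text \<open>\<open>A \<otimes> A \<otimes> A\<close> is bracketed to the right.\<close>

definition tensor_12 :: "('a::complex_algebra, 'a) tensor \<Rightarrow> ('a, ('a, 'a) tensor) tensor" where
  "tensor_12 = tensor_lift (\<lambda>a b. a \<otimes>\<^sub>t b \<otimes>\<^sub>t 1)"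

definition tensor_13 :: "('a::complex_algebra, 'a) tensor \<Rightarrow> ('a, ('a, 'a) tensor) tensor" where
  "tensor_13 = tensor_lift (\<lambda>a b. a \<otimes>\<^sub>t 1 \<otimes>\<^sub>t b)"

definition tensor_23 :: "('a::complex_algebra, 'a) tensor \<Rightarrow> ('a, ('a, 'a) tensor) tensor" where
  "tensor_23 = tensor_lift (\<lambda>a b. 1 \<otimes>\<^sub>t a \<otimes>\<^sub>t b)"

definition universal_R_matrix ::
  "('a::complex_algebra \<Rightarrow> ('a, 'a) tensor) \<Rightarrow> ('a, 'a) tensor \<Rightarrow> bool" where
  "universal_R_matrix \<Delta> R \<longleftrightarrow>
     (\<exists>R'. R * R' = 1 \<and> R' * R = 1) \<and>
     (\<forall>a. R * \<Delta> a = tensor_flip (\<Delta> a) * R) \<and>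
     tensor_assoc (tensor_map \<Delta> id R) = tensor_13 R * tensor_23 R \<and>
     tensor_map id \<Delta> R = tensor_13 R * tensor_12 R"


section \<open>The restricted quantum group\<close>

datatype gen = gen_E | gen_F | gen_K | gen_Kinv

datatype word = Word "gen list"

instantiation word :: monoid_add
begin
definition zero_word :: word where "0 = Word []"
fun plus_word :: "word \<Rightarrow> word \<Rightarrow> word" where "Word u + Word v = Word (u @ v)"
instance
proof
  fix a b c :: word
  show "a + b + c = a + (b + c)" by (cases a; cases b; cases c) simp
  show "0 + a = a" "a + 0 = a" by (cases a; simp add: zero_word_def)+
qed
end

text \<open>Words form the free monoid, written additively, so that the convolution product of
  \<^typ>\<open>word \<Rightarrow>\<^sub>0 complex\<close> makes it the free algebra on the four generators.\<close>

type_synonym free_algebra = "word \<Rightarrow>\<^sub>0 complex"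

definition free_gen :: "gen \<Rightarrow> free_algebra" where
  "free_gen g = Poly_Mapping.single (Word [g]) 1"

definition free_const :: "complex \<Rightarrow> free_algebra" where
  "free_const c = Poly_Mapping.single 0 c"

inductive_set two_sided_ideal :: "'a::ring_1 set \<Rightarrow> 'a set" for R where
  base: "r \<in> R \<Longrightarrow> r \<in> two_sided_ideal R"
| zero: "0 \<in> two_sided_ideal R"
| add: "x \<in> two_sided_ideal R \<Longrightarrow> y \<in> two_sided_ideal R \<Longrightarrow> x + y \<in> two_sided_ideal R"
| mult: "x \<in> two_sided_ideal R \<Longrightarrow> a * x * b \<in> two_sided_ideal R"

definition uisl2_relators :: "free_algebra set" where
  "uisl2_relators =
    (let E = free_gen gen_E; F = free_gen gen_F; K = free_gen gen_K; Kinv = free_gen gen_Kinv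
     in {K * Kinv - 1, Kinv * K - 1,
         K * E * Kinv - (- E),
         K * F * Kinv - (- F),
         (E * F - F * E) - free_const (1 / (2 * \<i>)) * (K - Kinv),
         E ^ 2, F ^ 2, K ^ 4 - 1})"

lemma two_sided_ideal_uminus: "x \<in> two_sided_ideal R \<Longrightarrow> - x \<in> two_sided_ideal R"
  using two_sided_ideal.mult[of x R "- 1" 1] by simp

quotient_type uisl2 = free_algebra / "\<lambda>x y. x - y \<in> two_sided_ideal uisl2_relators"
proof (rule equivpI)
  show "reflp (\<lambda>x y. x - y \<in> two_sided_ideal uisl2_relators)"
    by (auto simp: reflp_def intro: two_sided_ideal.zero)
  show "symp (\<lambda>x y. x - y \<in> two_sided_ideal uisl2_relators)"
    using two_sided_ideal_uminus by (fastforce simp: symp_def)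
  show "transp (\<lambda>x y. x - y \<in> two_sided_ideal uisl2_relators)"
    using two_sided_ideal.add by (fastforce simp: transp_def)
qed

lemma free_algebra_induct [case_names zero single add]:
  fixes p :: "'a \<Rightarrow>\<^sub>0 'b::comm_monoid_add"
  assumes "P 0" "\<And>w c. P (Poly_Mapping.single w c)" "\<And>p q. P p \<Longrightarrow> P q \<Longrightarrow> P (p + q)"
  shows "P p"
proof -
  have "P (\<Sum>w\<in>A. Poly_Mapping.single w (Poly_Mapping.lookup p w))" for A
    by (induction A rule: infinite_finite_induct) (auto intro: assms)
  moreover have "(\<Sum>w\<in>Poly_Mapping.keys p. Poly_Mapping.single w (Poly_Mapping.lookup p w)) = p"
  proof (rule poly_mapping_eqI)
    fix k
    show "Poly_Mapping.lookup (\<Sum>w\<in>Poly_Mapping.keys p. Poly_Mapping.single w (Poly_Mapping.lookup p w)) k = Poly_Mapping.lookup p k"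
      by (cases "k \<in> Poly_Mapping.keys p") (auto simp: lookup_sum lookup_single when_def in_keys_iff)
  qed
  ultimately show ?thesis by metis
qed

lemma free_const_central: "free_const c * p = p * free_const c"
  by (induction p rule: free_algebra_induct)
    (auto simp: free_const_def mult_single distrib_left distrib_right mult.commute)

lemma free_const_add: "free_const (c + d) = free_const c + free_const d"
  by (simp add: free_const_def single_add)

lemma free_const_mult: "free_const (c * d) = free_const c * free_const d"
  by (simp add: free_const_def mult_single)

lemma free_const_one: "free_const 1 = 1"
  by (simp add: free_const_def)

instantiation uisl2 :: complex_algebra
begin

lift_definition zero_uisl2 :: uisl2 is 0 .

lift_definition one_uisl2 :: uisl2 is 1 .

lift_definition plus_uisl2 :: "uisl2 \<Rightarrow> uisl2 \<Rightarrow> uisl2" is "(+)"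
  using two_sided_ideal.add by (metis add_diff_add)

lift_definition uminus_uisl2 :: "uisl2 \<Rightarrow> uisl2" is uminus
  using two_sided_ideal_uminus by fastforce

lift_definition minus_uisl2 :: "uisl2 \<Rightarrow> uisl2 \<Rightarrow> uisl2" is "(-)"
proof -
  fix p p' q q' :: free_algebra
  assume "p - p' \<in> two_sided_ideal uisl2_relators" "q - q' \<in> two_sided_ideal uisl2_relators"
  then have "(p - p') + - (q - q') \<in> two_sided_ideal uisl2_relators"
    by (intro two_sided_ideal.add two_sided_ideal_uminus)
  then show "p - q - (p' - q') \<in> two_sided_ideal uisl2_relators" by (simp add: algebra_simps)
qed

lift_definition times_uisl2 :: "uisl2 \<Rightarrow> uisl2 \<Rightarrow> uisl2" is "(*)"
proof -
  fix p p' q q' :: free_algebra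
  assume "p - p' \<in> two_sided_ideal uisl2_relators" "q - q' \<in> two_sided_ideal uisl2_relators"
  then have "1 * (p - p') * q + p' * (q - q') * 1 \<in> two_sided_ideal uisl2_relators"
    by (intro two_sided_ideal.add two_sided_ideal.mult)
  then show "p * q - p' * q' \<in> two_sided_ideal uisl2_relators" by (simp add: algebra_simps)
qed

lift_definition scaleC_uisl2 :: "complex \<Rightarrow> uisl2 \<Rightarrow> uisl2" is "\<lambda>c p. free_const c * p"
proof -
  fix c and p q :: free_algebra
  assume "p - q \<in> two_sided_ideal uisl2_relators"
  then have "free_const c * (p - q) * 1 \<in> two_sided_ideal uisl2_relators"
    by (rule two_sided_ideal.mult)
  then show "free_const c * p - free_const c * q \<in> two_sided_ideal uisl2_relators"
    by (simp add: algebra_simps)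
qed

instance
proof
  fix a b c :: uisl2 and k l :: complex
  have *: "p - q \<in> two_sided_ideal uisl2_relators" if "p = q" for p q
    using that two_sided_ideal.zero by simp
  show "a + b + c = a + (b + c)" by transfer (rule *, simp add: algebra_simps)
  show "a + b = b + a" by transfer (rule *, simp add: algebra_simps)
  show "0 + a = a" by transfer (rule *, simp)
  show "- a + a = 0" by transfer (rule *, simp)
  show "a - b = a + - b" by transfer (rule *, simp)
  show "a * b * c = a * (b * c)" by transfer (rule *, simp add: mult.assoc)
  show "1 * a = a" by transfer (rule *, simp)
  show "a * 1 = a" by transfer (rule *, simp)
  show "(a + b) * c = a * c + b * c" by transfer (rule *, simp add: algebra_simps)
  show "a * (b + c) = a * b + a * c" by transfer (rule *, simp add: algebra_simps)
  show "k *\<^sub>C (a + b) = k *\<^sub>C a + k *\<^sub>C b" by transfer (rule *, simp add: algebra_simps)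
  show "(k + l) *\<^sub>C a = k *\<^sub>C a + l *\<^sub>C a" by transfer (rule *, simp add: algebra_simps free_const_add)
  show "k *\<^sub>C l *\<^sub>C a = (k * l) *\<^sub>C a" by transfer (rule *, simp add: mult.assoc free_const_mult)
  show "1 *\<^sub>C a = a" by transfer (rule *, simp add: free_const_one)
  show "(k *\<^sub>C a) * b = k *\<^sub>C (a * b)" by transfer (rule *, simp add: mult.assoc)
  show "a * (k *\<^sub>C b) = k *\<^sub>C (a * b)"
    by transfer (rule *, metis mult.assoc free_const_central)
qed

end

lift_definition Q_gen :: "gen \<Rightarrow> uisl2" is free_gen .

abbreviation "Q_E \<equiv> Q_gen gen_E"
abbreviation "Q_F \<equiv> Q_gen gen_F"
abbreviation "Q_K \<equiv> Q_gen gen_K"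
abbreviation "Q_Kinv \<equiv> Q_gen gen_Kinv"

fun word_eval :: "(gen \<Rightarrow> 'a::complex_algebra) \<Rightarrow> word \<Rightarrow> 'a" where
  "word_eval f (Word u) = prod_list (map f u)"

definition free_eval :: "(gen \<Rightarrow> 'a::complex_algebra) \<Rightarrow> free_algebra \<Rightarrow> 'a" where
  "free_eval f p = (\<Sum>w\<in>Poly_Mapping.keys p. Poly_Mapping.lookup p w *\<^sub>C word_eval f w)"

text \<open>The algebra map on the quotient with prescribed values on the generators; it is only used
  when these values satisfy the defining relations, and is then independent of the representative.\<close>

definition Q_lift :: "(gen \<Rightarrow> 'a::complex_algebra) \<Rightarrow> uisl2 \<Rightarrow> 'a" where
  "Q_lift f x = free_eval f (rep_uisl2 x)"

definition Q_relations :: "(gen \<Rightarrow> 'a::complex_algebra) \<Rightarrow> bool" where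
  "Q_relations f \<longleftrightarrow>
    (let E = f gen_E; F = f gen_F; K = f gen_K; Kinv = f gen_Kinv
     in K * Kinv = 1 \<and> Kinv * K = 1 \<and> K * E * Kinv = - E \<and> K * F * Kinv = - F \<and>
        E * F - F * E = (1 / (2 * \<i>)) *\<^sub>C (K - Kinv) \<and> E ^ 2 = 0 \<and> F ^ 2 = 0 \<and> K ^ 4 = 1)"

lemma free_eval_superset:
  assumes "finite A" "Poly_Mapping.keys p \<subseteq> A"
  shows "free_eval f p = (\<Sum>w\<in>A. Poly_Mapping.lookup p w *\<^sub>C word_eval f w)"
  unfolding free_eval_def using assms by (intro sum.mono_neutral_left) (auto simp: in_keys_iff)

lemma free_eval_add: "free_eval f (p + q) = free_eval f p + free_eval f q"
proof -
  let ?A = "Poly_Mapping.keys p \<union> Poly_Mapping.keys q"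
  have "Poly_Mapping.keys (p + q) \<subseteq> ?A" by (rule Poly_Mapping.keys_add)
  then show ?thesis
    by (simp add: free_eval_superset[of ?A] lookup_add scaleC_add_left sum.distrib)
qed

lemma free_eval_single: "free_eval f (Poly_Mapping.single w c) = c *\<^sub>C word_eval f w"
  by (cases "c = 0") (auto simp: free_eval_def)

lemma word_eval_add: "word_eval f (u + v) = word_eval f u * word_eval f v"
  by (cases u; cases v) simp

lemma word_eval_zero [simp]: "word_eval f 0 = 1"
  by (simp add: zero_word_def)

lemma free_eval_0 [simp]: "free_eval f 0 = 0" by (simp add: free_eval_def)

lemma free_eval_mult: "free_eval f (p * q) = free_eval f p * free_eval f q"
proof (induction p rule: free_algebra_induct)
  case (single w c)
  show ?case
    by (induction q rule: free_algebra_induct)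
      (auto simp: mult_single free_eval_single word_eval_add free_eval_add distrib_left
        mult_scaleC_left mult_scaleC_right scaleC_scaleC mult.commute)
qed (auto simp: distrib_right free_eval_add)

lemma free_eval_one [simp]: "free_eval f 1 = 1"
  using free_eval_single[of f 0 1] by simp

lemma free_eval_const: "free_eval f (free_const c) = c *\<^sub>C 1"
  by (simp add: free_const_def free_eval_single)

lemma free_eval_gen [simp]: "free_eval f (free_gen g) = f g"
  by (simp add: free_gen_def free_eval_single)

lemma free_eval_uminus: "free_eval f (- p) = - free_eval f p"
  using free_eval_add[of f p "- p"] by (simp add: eq_neg_iff_add_eq_0 add.commute)

lemma free_eval_diff: "free_eval f (p - q) = free_eval f p - free_eval f q"
  using free_eval_add[of f p "- q"] by (simp add: free_eval_uminus)

lemma free_eval_power: "free_eval f (p ^ n) = free_eval f p ^ n"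
  by (induction n) (auto simp: free_eval_mult)

lemma free_eval_ideal:
  assumes "Q_relations f" "p \<in> two_sided_ideal uisl2_relators"
  shows "free_eval f p = 0"
  using assms(2)
proof induction
  case (base r)
  then show ?case using assms(1)
    by (auto simp: uisl2_relators_def Q_relations_def Let_def free_eval_diff free_eval_mult free_eval_add
        free_eval_uminus free_eval_const free_eval_power mult_scaleC_left)
qed (auto simp: free_eval_add free_eval_mult)

lemma Q_lift_abs:
  assumes "Q_relations f"
  shows "Q_lift f (abs_uisl2 p) = free_eval f p"
proof -
  have "rep_uisl2 (abs_uisl2 p) - p \<in> two_sided_ideal uisl2_relators"
    by (simp add: Quotient3_abs_rep[OF Quotient3_uisl2] flip: uisl2.abs_eq_iff)
  from free_eval_ideal[OF assms this] show ?thesis by (simp add: Q_lift_def free_eval_diff)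
qed

lemma Q_abs_cases: "\<exists>p. x = abs_uisl2 p"
  by (induction x rule: uisl2.abs_induct) blast

lemma Q_lift_gen [simp]: "Q_relations f \<Longrightarrow> Q_lift f (Q_gen g) = f g"
  by (simp add: Q_gen.abs_eq Q_lift_abs)

lemma algebra_map_Q_lift:
  assumes "Q_relations f"
  shows "algebra_map (Q_lift f)"
proof -
  note [simp] = Q_lift_abs[OF assms]
  have "Q_lift f (x + y) = Q_lift f x + Q_lift f y" "Q_lift f (x * y) = Q_lift f x * Q_lift f y"
    "Q_lift f (c *\<^sub>C x) = c *\<^sub>C Q_lift f x" for x y c
  proof -
    obtain p q where "x = abs_uisl2 p" "y = abs_uisl2 q" using Q_abs_cases by metis
    then show "Q_lift f (x + y) = Q_lift f x + Q_lift f y" "Q_lift f (x * y) = Q_lift f x * Q_lift f y"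
      "Q_lift f (c *\<^sub>C x) = c *\<^sub>C Q_lift f x"
      by (simp_all add: plus_uisl2.abs_eq times_uisl2.abs_eq scaleC_uisl2.abs_eq free_eval_add
          free_eval_mult free_eval_const mult_scaleC_left)
  qed
  moreover have "Q_lift f 1 = 1" by (simp add: one_uisl2.abs_eq)
  ultimately show ?thesis by (auto simp: algebra_map_def clinear_map_def)
qed

lemma Q_induct [case_names one gen add scale mult]:
  assumes one: "P 1" and gen: "\<And>g. P (Q_gen g)" and add: "\<And>x y. P x \<Longrightarrow> P y \<Longrightarrow> P (x + y)"
    and scale: "\<And>c x. P x \<Longrightarrow> P (c *\<^sub>C x)" and mult: "\<And>x y. P x \<Longrightarrow> P y \<Longrightarrow> P (x * y)"
  shows "P x"
proof -
  obtain p where x: "x = abs_uisl2 p" using Q_abs_cases by metis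
  have word: "P (abs_uisl2 (Poly_Mapping.single (Word u) 1))" for u
  proof (induction u)
    case Nil
    then show ?case using one by (simp add: one_uisl2.abs_eq flip: zero_word_def)
  next
    case (Cons g u)
    have "abs_uisl2 (Poly_Mapping.single (Word (g # u)) 1) =
      Q_gen g * abs_uisl2 (Poly_Mapping.single (Word u) 1)"
      by (simp add: Q_gen.abs_eq times_uisl2.abs_eq free_gen_def mult_single)
    then show ?case using mult[OF gen Cons] by simp
  qed
  have "P (abs_uisl2 p)"
  proof (induction p rule: free_algebra_induct)
    case zero
    have "P (0 *\<^sub>C 1)" by (intro scale one)
    then show ?case by (simp add: zero_uisl2.abs_eq)
  next
    case (single w c)
    obtain u where w: "w = Word u" by (cases w)
    have "abs_uisl2 (Poly_Mapping.single w c) = c *\<^sub>C abs_uisl2 (Poly_Mapping.single (Word u) 1)"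
      by (simp add: scaleC_uisl2.abs_eq free_const_def mult_single w)
    then show ?case using scale[OF word] by simp
  next
    case (add p q)
    then show ?case using assms(3) by (metis plus_uisl2.abs_eq)
  qed
  then show ?thesis using x by simp
qed

lemma Q_relations_Q_gen: "Q_relations Q_gen"
proof -
  have r: "abs_uisl2 p = abs_uisl2 q" if "p - q \<in> uisl2_relators" for p q
    using that by (simp add: uisl2.abs_eq_iff two_sided_ideal.base)
  have pow: "abs_uisl2 p ^ n = abs_uisl2 (p ^ n)" for p n
    by (induction n) (simp_all add: one_uisl2.abs_eq times_uisl2.abs_eq)
  show ?thesis
    unfolding Q_relations_def Let_def Q_gen.abs_eq
    by (simp only: pow times_uisl2.abs_eq one_uisl2.abs_eq zero_uisl2.abs_eq uminus_uisl2.abs_eq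
        minus_uisl2.abs_eq scaleC_uisl2.abs_eq; intro conjI r; simp add: uisl2_relators_def Let_def)
qed

text \<open>The opposite algebra, needed because the antipode is anti-multiplicative.\<close>

datatype 'a opp = Opp (unopp: 'a)

instantiation opp :: (complex_algebra) complex_algebra
begin
definition "0 = Opp 0"
definition "1 = Opp 1"
definition "x + y = Opp (unopp x + unopp y)"
definition "x - y = Opp (unopp x - unopp y)"
definition "- x = Opp (- unopp x)"
definition "x * y = Opp (unopp y * unopp x)"
definition "c *\<^sub>C x = Opp (c *\<^sub>C unopp x)"
instance
  by standard
    (auto simp: zero_opp_def one_opp_def plus_opp_def minus_opp_def uminus_opp_def times_opp_def
      scaleC_opp_def algebra_simps scaleC_add_left scaleC_add_right scaleC_scaleC mult_scaleC_left
      mult_scaleC_right opp.expand)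
end

definition Q_comult :: "uisl2 \<Rightarrow> (uisl2, uisl2) tensor" where
  "Q_comult = Q_lift (\<lambda>g. case g of
      gen_E \<Rightarrow> 1 \<otimes>\<^sub>t Q_E + Q_E \<otimes>\<^sub>t Q_K
    | gen_F \<Rightarrow> Q_Kinv \<otimes>\<^sub>t Q_F + Q_F \<otimes>\<^sub>t 1
    | gen_K \<Rightarrow> Q_K \<otimes>\<^sub>t Q_K
    | gen_Kinv \<Rightarrow> Q_Kinv \<otimes>\<^sub>t Q_Kinv)"

definition Q_counit :: "uisl2 \<Rightarrow> complex" where
  "Q_counit = Q_lift (\<lambda>g. case g of gen_E \<Rightarrow> 0 | gen_F \<Rightarrow> 0 | gen_K \<Rightarrow> 1 | gen_Kinv \<Rightarrow> 1)"

definition Q_antipode :: "uisl2 \<Rightarrow> uisl2" where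
  "Q_antipode x = unopp (Q_lift (\<lambda>g. Opp (case g of
      gen_E \<Rightarrow> - (Q_E * Q_Kinv)
    | gen_F \<Rightarrow> - (Q_K * Q_F)
    | gen_K \<Rightarrow> Q_Kinv
    | gen_Kinv \<Rightarrow> Q_K)) x)"

lemma Q_rels:
  "Q_K * Q_Kinv = 1" "Q_Kinv * Q_K = 1" "Q_K * Q_E = - (Q_E * Q_K)" "Q_K * Q_F = - (Q_F * Q_K)"
  "Q_Kinv * Q_E = - (Q_E * Q_Kinv)" "Q_Kinv * Q_F = - (Q_F * Q_Kinv)"
  "Q_E * Q_F = Q_F * Q_E + (1 / (2 * \<i>)) *\<^sub>C (Q_K - Q_Kinv)" "Q_E * Q_E = 0" "Q_F * Q_F = 0"
  "Q_K ^ 4 = 1"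
proof -
  have r: "Q_K * Q_Kinv = 1" "Q_Kinv * Q_K = 1" "Q_K * Q_E * Q_Kinv = - Q_E" "Q_K * Q_F * Q_Kinv = - Q_F"
    "Q_E * Q_F - Q_F * Q_E = (1 / (2 * \<i>)) *\<^sub>C (Q_K - Q_Kinv)" "Q_E ^ 2 = 0" "Q_F ^ 2 = 0" "Q_K ^ 4 = 1"
    using Q_relations_Q_gen unfolding Q_relations_def Let_def by auto
  then show "Q_K * Q_Kinv = 1" "Q_Kinv * Q_K = 1" "Q_K ^ 4 = 1" "Q_E * Q_E = 0" "Q_F * Q_F = 0"
    by (simp_all only: power2_eq_square)
  show "Q_E * Q_F = Q_F * Q_E + (1 / (2 * \<i>)) *\<^sub>C (Q_K - Q_Kinv)"
    using r(5) by (simp add: diff_eq_eq add.commute)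
  have *: "Q_K * x = - (x * Q_K)" "Q_Kinv * x = - (x * Q_Kinv)" if "Q_K * x * Q_Kinv = - x" for x
  proof -
    have "Q_K * x = (Q_K * x * Q_Kinv) * Q_K" using r(2) by (simp add: mult.assoc)
    then show 1: "Q_K * x = - (x * Q_K)" using that by simp
    have "x * Q_Kinv = Q_Kinv * (Q_K * x) * Q_Kinv" using r(2) by (simp add: mult.assoc[symmetric])
    also have "\<dots> = - (Q_Kinv * x)" using that by (simp add: mult.assoc)
    finally show "Q_Kinv * x = - (x * Q_Kinv)" by simp
  qed
  show "Q_K * Q_E = - (Q_E * Q_K)" "Q_K * Q_F = - (Q_F * Q_K)"
    "Q_Kinv * Q_E = - (Q_E * Q_Kinv)" "Q_Kinv * Q_F = - (Q_F * Q_Kinv)"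
    using *[OF r(3)] *[OF r(4)] by auto
qed

lemma Q_rels_assoc:
  "Q_K * (Q_Kinv * x) = x" "Q_Kinv * (Q_K * x) = x" "Q_K * (Q_E * x) = - (Q_E * (Q_K * x))"
  "Q_K * (Q_F * x) = - (Q_F * (Q_K * x))"
  "Q_Kinv * (Q_E * x) = - (Q_E * (Q_Kinv * x))" "Q_Kinv * (Q_F * x) = - (Q_F * (Q_Kinv * x))"
  "Q_E * (Q_F * x) = Q_F * (Q_E * x) + ((1 / (2 * \<i>)) *\<^sub>C (Q_K - Q_Kinv)) * x"
  "Q_E * (Q_E * x) = 0" "Q_F * (Q_F * x) = 0"
  by (simp_all only: mult.assoc[symmetric] Q_rels distrib_right minus_mult_left mult_1_left mult_zero_left)

lemma Q_Kinv_power4: "Q_Kinv ^ 4 = 1"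
proof -
  have "Q_Kinv ^ n * Q_K ^ n = 1" for n
  proof (induction n)
    case (Suc n)
    have "Q_Kinv ^ Suc n * Q_K ^ Suc n = Q_Kinv ^ n * (Q_Kinv * (Q_K * Q_K ^ n))"
      by (simp add: power_Suc2 mult.assoc del: power_Suc) (simp add: power_commutes)
    then show ?case using Suc by (simp add: Q_rels_assoc)
  qed simp
  from this[of 4] show ?thesis by (simp add: Q_rels)
qed

lemma tens_power: "(a \<otimes>\<^sub>t b) ^ n = a ^ n \<otimes>\<^sub>t b ^ n"
  by (induction n) (auto simp: one_tensor_def tens_mult)

lemma tens_uminus: "(- a) \<otimes>\<^sub>t b = - (a \<otimes>\<^sub>t b)" "a \<otimes>\<^sub>t (- b) = - (a \<otimes>\<^sub>t b)"
  by (simp_all add: clinear_mapD(4)[OF clinear_tens(2)] clinear_mapD(4)[OF clinear_tens(1)])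

lemma tens_zero [simp]: "0 \<otimes>\<^sub>t b = 0" "a \<otimes>\<^sub>t 0 = 0"
  by (simp_all add: clinear_mapD(3)[OF clinear_tens(2)] clinear_mapD(3)[OF clinear_tens(1)])

lemma tens_diff: "(a - a') \<otimes>\<^sub>t b = a \<otimes>\<^sub>t b - a' \<otimes>\<^sub>t b" "a \<otimes>\<^sub>t (b - b') = a \<otimes>\<^sub>t b - a \<otimes>\<^sub>t b'"
  by (simp_all add: clinear_mapD(5)[OF clinear_tens(2)] clinear_mapD(5)[OF clinear_tens(1)])

lemma Q_relations_comult: "Q_relations (\<lambda>g. case g of
      gen_E \<Rightarrow> 1 \<otimes>\<^sub>t Q_E + Q_E \<otimes>\<^sub>t Q_K
    | gen_F \<Rightarrow> Q_Kinv \<otimes>\<^sub>t Q_F + Q_F \<otimes>\<^sub>t 1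
    | gen_K \<Rightarrow> Q_K \<otimes>\<^sub>t Q_K
    | gen_Kinv \<Rightarrow> Q_Kinv \<otimes>\<^sub>t Q_Kinv)"
  unfolding Q_relations_def Let_def gen.case
proof (intro conjI)
  show "(Q_K \<otimes>\<^sub>t Q_K) ^ 4 = 1" by (simp add: tens_power Q_rels one_tensor_def)
qed (simp_all add: power2_eq_square tens_mult distrib_left distrib_right left_diff_distrib
    right_diff_distrib mult.assoc Q_rels Q_rels_assoc
    one_tensor_def tens_uminus tens_add_left tens_add_right tens_diff scaleC_diff_right
    scaleC_tens_left[symmetric] scaleC_tens_right[symmetric])

lemma Q_relations_counit:
  "Q_relations (\<lambda>g. case g of gen_E \<Rightarrow> 0 | gen_F \<Rightarrow> 0 | gen_K \<Rightarrow> 1 | gen_Kinv \<Rightarrow> (1 :: complex))"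
  by (simp add: Q_relations_def Let_def scaleC_complex_def)

lemma opp_power: "Opp x ^ n = Opp (x ^ n)"
  by (induction n) (auto simp: one_opp_def times_opp_def power_commutes)

lemma Q_relations_antipode: "Q_relations (\<lambda>g. Opp (case g of
      gen_E \<Rightarrow> - (Q_E * Q_Kinv)
    | gen_F \<Rightarrow> - (Q_K * Q_F)
    | gen_K \<Rightarrow> Q_Kinv
    | gen_Kinv \<Rightarrow> Q_K))"
  unfolding Q_relations_def Let_def gen.case opp_power
  by (simp add: times_opp_def one_opp_def zero_opp_def minus_opp_def uminus_opp_def scaleC_opp_def
      Q_Kinv_power4 power2_eq_square mult.assoc Q_rels Q_rels_assoc algebra_simps scaleC_diff_right
      mult_scaleC_right mult_scaleC_left)

lemma algebra_map_Q_comult: "algebra_map Q_comult"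
  unfolding Q_comult_def by (rule algebra_map_Q_lift[OF Q_relations_comult])

lemma algebra_map_Q_counit: "algebra_map Q_counit"
  unfolding Q_counit_def by (rule algebra_map_Q_lift[OF Q_relations_counit])

lemma Q_comult_gen:
  "Q_comult Q_E = 1 \<otimes>\<^sub>t Q_E + Q_E \<otimes>\<^sub>t Q_K" "Q_comult Q_F = Q_Kinv \<otimes>\<^sub>t Q_F + Q_F \<otimes>\<^sub>t 1"
  "Q_comult Q_K = Q_K \<otimes>\<^sub>t Q_K" "Q_comult Q_Kinv = Q_Kinv \<otimes>\<^sub>t Q_Kinv"
  by (simp_all add: Q_comult_def Q_relations_comult)

lemma Q_counit_gen:
  "Q_counit Q_E = 0" "Q_counit Q_F = 0" "Q_counit Q_K = 1" "Q_counit Q_Kinv = 1"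
  by (simp_all add: Q_counit_def Q_relations_counit)

lemma Q_antipode_gen:
  "Q_antipode Q_E = - (Q_E * Q_Kinv)" "Q_antipode Q_F = - (Q_K * Q_F)"
  "Q_antipode Q_K = Q_Kinv" "Q_antipode Q_Kinv = Q_K"
  by (simp_all add: Q_antipode_def Q_relations_antipode)

lemma Q_antipode_map:
  "Q_antipode (x + y) = Q_antipode x + Q_antipode y" "Q_antipode (c *\<^sub>C x) = c *\<^sub>C Q_antipode x"
  "Q_antipode 1 = 1" "Q_antipode (x * y) = Q_antipode y * Q_antipode x" "clinear_map Q_antipode"
  by (simp_all add: Q_antipode_def clinear_map_def algebra_mapD[OF algebra_map_Q_lift[OF Q_relations_antipode]]
      plus_opp_def scaleC_opp_def one_opp_def times_opp_def)

lemma algebra_map_eq_Q: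
  assumes "algebra_map f" "algebra_map g" "\<And>h. f (Q_gen h) = g (Q_gen h)"
  shows "f x = g x"
  by (induction x rule: Q_induct)
    (simp_all add: assms(3) algebra_mapD[OF assms(1)] algebra_mapD[OF assms(2)])

lemma bilinear_scale_left: "clinear_map f \<Longrightarrow> bilinear_map (\<lambda>a b. f a *\<^sub>C b)" for f :: "_ \<Rightarrow> complex"
  by (rule bilinear_mapI)
    (auto simp: clinear_map_def scaleC_add_left scaleC_add_right scaleC_scaleC scaleC_complex_def mult.commute)

lemma bilinear_scale_right: "clinear_map f \<Longrightarrow> bilinear_map (\<lambda>a b. f b *\<^sub>C a)" for f :: "_ \<Rightarrow> complex"
  by (rule bilinear_mapI)
    (auto simp: clinear_map_def scaleC_add_left scaleC_add_right scaleC_scaleC scaleC_complex_def mult.commute)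

lemma algebra_map_counit_left:
  fixes \<epsilon> :: "'a::complex_algebra \<Rightarrow> complex"
  assumes "algebra_map \<epsilon>"
  shows "algebra_map (tensor_lift (\<lambda>a b :: 'b::complex_algebra. \<epsilon> a *\<^sub>C b))"
  using bilinear_scale_left[of \<epsilon>] algebra_mapD[OF assms]
  by (intro algebra_map_tensorI clinear_tensor_lift)
    (auto simp: one_tensor_def tens_mult scaleC_scaleC mult_scaleC_left mult_scaleC_right mult.commute)

lemma algebra_map_counit_right:
  fixes \<epsilon> :: "'a::complex_algebra \<Rightarrow> complex"
  assumes "algebra_map \<epsilon>"
  shows "algebra_map (tensor_lift (\<lambda>(a :: 'b::complex_algebra) b. \<epsilon> b *\<^sub>C a))"
  using bilinear_scale_right[of \<epsilon>] algebra_mapD[OF assms]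
  by (intro algebra_map_tensorI clinear_tensor_lift)
    (auto simp: one_tensor_def tens_mult scaleC_scaleC mult_scaleC_left mult_scaleC_right mult.commute)

lemma bilinear_mult: "clinear_map f \<Longrightarrow> clinear_map g \<Longrightarrow> bilinear_map (\<lambda>a b. f a * g b)"
  for f :: "_ \<Rightarrow> 'a::complex_algebra"
  by (rule bilinear_mapI) (auto simp: clinear_map_def distrib_left distrib_right mult_scaleC_left mult_scaleC_right)

theorem hopf_algebra_Q: "hopf_algebra Q_comult Q_counit Q_antipode"
  unfolding hopf_algebra_def
proof (intro conjI allI algebra_map_Q_comult algebra_map_Q_counit Q_antipode_map(5))
  note D = algebra_mapD[OF algebra_map_Q_comult] and e = algebra_mapD[OF algebra_map_Q_counit]
  note tm = tensor_map_tens[OF D(8) clinear_id(2)] tensor_map_tens[OF clinear_id(2) D(8)]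
  fix x
  show "tensor_assoc (tensor_map Q_comult id (Q_comult x)) = tensor_map id Q_comult (Q_comult x)"
  proof (rule algebra_map_eq_Q[of _ _ x])
    note Di = algebra_map_comp[OF algebra_map_tensor_map[OF algebra_map_Q_comult algebra_map_id(2)] algebra_map_Q_comult]
      and iD = algebra_map_comp[OF algebra_map_tensor_map[OF algebra_map_id(2) algebra_map_Q_comult] algebra_map_Q_comult]
    show "algebra_map (\<lambda>x. tensor_assoc (tensor_map Q_comult id (Q_comult x)))"
      by (rule algebra_map_comp[OF algebra_map_tensor_assoc Di])
    show "algebra_map (\<lambda>x. tensor_map id Q_comult (Q_comult x))"
      by (rule iD)
    note l = clinear_mapD[OF clinear_tensor_map[OF D(8) clinear_id(2)]]
      clinear_mapD[OF clinear_tensor_map[OF clinear_id(2) D(8)]] clinear_mapD[OF clinear_tensor_assoc]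
    show "tensor_assoc (tensor_map Q_comult id (Q_comult (Q_gen h))) =
      tensor_map id Q_comult (Q_comult (Q_gen h))" for h
      by (cases h) (simp_all add: Q_comult_gen tm l D tens_add_left tens_add_right one_tensor_def)
  qed
  show "tensor_lift (\<lambda>a. (*\<^sub>C) (Q_counit a)) (Q_comult x) = x"
  proof (rule algebra_map_eq_Q[of _ "\<lambda>x. x" x])
    show "algebra_map (\<lambda>x. tensor_lift (\<lambda>a. (*\<^sub>C) (Q_counit a)) (Q_comult x) :: uisl2)"
      by (rule algebra_map_comp[OF algebra_map_counit_left[OF algebra_map_Q_counit] algebra_map_Q_comult])
    show "tensor_lift (\<lambda>a. (*\<^sub>C) (Q_counit a)) (Q_comult (Q_gen h)) = Q_gen h" for h
      by (cases h) (simp_all add: Q_comult_gen bilinear_scale_left[OF e(8)] Q_counit_gen e)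
  qed auto
  show "tensor_lift (\<lambda>a b. Q_counit b *\<^sub>C a) (Q_comult x) = x"
  proof (rule algebra_map_eq_Q[of _ "\<lambda>x. x" x])
    show "algebra_map (\<lambda>x. tensor_lift (\<lambda>a b. Q_counit b *\<^sub>C a) (Q_comult x) :: uisl2)"
      by (rule algebra_map_comp[OF algebra_map_counit_right[OF algebra_map_Q_counit] algebra_map_Q_comult])
    show "tensor_lift (\<lambda>a b. Q_counit b *\<^sub>C a) (Q_comult (Q_gen h)) = Q_gen h" for h
      by (cases h) (simp_all add: Q_comult_gen bilinear_scale_right[OF e(8)] Q_counit_gen e)
  qed auto
  let ?L = "tensor_lift (\<lambda>a b. Q_antipode a * b)"
  have bL: "bilinear_map (\<lambda>a b. Q_antipode a * b)"
    by (rule bilinear_mult[OF Q_antipode_map(5) clinear_id(1)])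
  note lL = clinear_mapD[OF clinear_tensor_lift[OF bL]]
  have mL: "?L (s * t) = k *\<^sub>C ?L t" if "?L s = k *\<^sub>C 1" for s t k
  proof (induction t rule: tensor_induct)
    case (tens c d)
    have "?L (s * c \<otimes>\<^sub>t d) = Q_antipode c * ?L s * d"
      by (induction s rule: tensor_induct)
        (simp_all add: bL lL tens_mult Q_antipode_map mult.assoc distrib_right distrib_left)
    then show ?case using that by (simp add: bL mult_scaleC_left mult_scaleC_right)
  qed (simp_all add: lL distrib_left scaleC_add_right)
  show "?L (Q_comult x) = Q_counit x *\<^sub>C 1"
  proof (induction x rule: Q_induct)
    case (gen g)
    then show ?case by (cases g)
      (simp_all add: Q_comult_gen bL lL Q_antipode_gen Q_antipode_map Q_counit_gen Q_rels mult.assoc)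
  next
    case (mult x y)
    then show ?case by (simp add: D e mL scaleC_scaleC)
  qed (simp_all add: D e lL bL one_tensor_def Q_antipode_map scaleC_add_left scaleC_scaleC scaleC_complex_def)
  let ?R = "tensor_lift (\<lambda>a b. a * Q_antipode b)"
  have bR: "bilinear_map (\<lambda>a b. a * Q_antipode b)"
    by (rule bilinear_mult[OF clinear_id(1) Q_antipode_map(5)])
  note lR = clinear_mapD[OF clinear_tensor_lift[OF bR]]
  have mR: "?R (s * t) = k *\<^sub>C ?R s" if "?R t = k *\<^sub>C 1" for s t k
  proof (induction s rule: tensor_induct)
    case (tens c d)
    have "?R (c \<otimes>\<^sub>t d * t) = c * ?R t * Q_antipode d"
      by (induction t rule: tensor_induct)
        (simp_all add: bR lR tens_mult Q_antipode_map mult.assoc distrib_right distrib_left)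
    then show ?case using that by (simp add: bR mult_scaleC_left mult_scaleC_right)
  qed (simp_all add: lR distrib_right scaleC_add_right)
  show "?R (Q_comult x) = Q_counit x *\<^sub>C 1"
  proof (induction x rule: Q_induct)
    case (gen g)
    then show ?case by (cases g)
      (simp_all add: Q_comult_gen bR lR Q_antipode_gen Q_antipode_map Q_counit_gen Q_rels Q_rels_assoc
        mult.assoc)
  next
    case (mult x y)
    then show ?case by (simp add: D e mR scaleC_scaleC mult.commute)
  qed (simp_all add: D e lR bR one_tensor_def Q_antipode_map scaleC_add_left scaleC_scaleC scaleC_complex_def)
qed

section \<open>Monoidal categories and braidings\<close>

record ('o, 'm) monoidal_structure =
  ob :: "'o set"
  hom :: "'o \<Rightarrow> 'o \<Rightarrow> 'm set"
  cmp :: "'m \<Rightarrow> 'm \<Rightarrow> 'm" \<comment> \<open>\<open>cmp g f\<close> is \<open>g\<close> after \<open>f\<close>\<close>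
  idn :: "'o \<Rightarrow> 'm"
  tob :: "'o \<Rightarrow> 'o \<Rightarrow> 'o"
  tmor :: "'m \<Rightarrow> 'm \<Rightarrow> 'm"
  unt :: "'o"
  asc :: "'o \<Rightarrow> 'o \<Rightarrow> 'o \<Rightarrow> 'm" \<comment> \<open>from \<open>(X \<otimes> Y) \<otimes> Z\<close> to \<open>X \<otimes> (Y \<otimes> Z)\<close>\<close>
  asc_inv :: "'o \<Rightarrow> 'o \<Rightarrow> 'o \<Rightarrow> 'm"
  lun :: "'o \<Rightarrow> 'm" \<comment> \<open>from \<open>1 \<otimes> X\<close> to \<open>X\<close>\<close>
  run :: "'o \<Rightarrow> 'm" \<comment> \<open>from \<open>X \<otimes> 1\<close> to \<open>X\<close>\<close>

definition iso_mor :: "('o, 'm) monoidal_structure \<Rightarrow> 'o \<Rightarrow> 'o \<Rightarrow> 'm \<Rightarrow> bool" where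
  "iso_mor C X Y f \<longleftrightarrow> f \<in> hom C X Y \<and>
     (\<exists>g\<in>hom C Y X. cmp C g f = idn C X \<and> cmp C f g = idn C Y)"

locale monoidal_category =
  fixes C :: "('o, 'm) monoidal_structure"
  assumes cmp_hom: "\<lbrakk>X \<in> ob C; Y \<in> ob C; Z \<in> ob C; f \<in> hom C X Y; g \<in> hom C Y Z\<rbrakk> \<Longrightarrow> cmp C g f \<in> hom C X Z"
    and idn_hom: "X \<in> ob C \<Longrightarrow> idn C X \<in> hom C X X"
    and cmp_assoc: "\<lbrakk>X \<in> ob C; Y \<in> ob C; Z \<in> ob C; W \<in> ob C; f \<in> hom C X Y; g \<in> hom C Y Z; h \<in> hom C Z W\<rbrakk>
      \<Longrightarrow> cmp C h (cmp C g f) = cmp C (cmp C h g) f"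
    and cmp_idn: "\<lbrakk>X \<in> ob C; Y \<in> ob C; f \<in> hom C X Y\<rbrakk> \<Longrightarrow> cmp C f (idn C X) = f \<and> cmp C (idn C Y) f = f"
    and tob_ob: "\<lbrakk>X \<in> ob C; Y \<in> ob C\<rbrakk> \<Longrightarrow> tob C X Y \<in> ob C"
    and unt_ob: "unt C \<in> ob C"
    and tmor_hom: "\<lbrakk>X \<in> ob C; X' \<in> ob C; Y \<in> ob C; Y' \<in> ob C; f \<in> hom C X X'; g \<in> hom C Y Y'\<rbrakk>
      \<Longrightarrow> tmor C f g \<in> hom C (tob C X Y) (tob C X' Y')"
    and tmor_idn: "\<lbrakk>X \<in> ob C; Y \<in> ob C\<rbrakk> \<Longrightarrow> tmor C (idn C X) (idn C Y) = idn C (tob C X Y)"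
    and tmor_cmp: "\<lbrakk>X \<in> ob C; X' \<in> ob C; X'' \<in> ob C; Y \<in> ob C; Y' \<in> ob C; Y'' \<in> ob C;
        f \<in> hom C X X'; f' \<in> hom C X' X''; g \<in> hom C Y Y'; g' \<in> hom C Y' Y''\<rbrakk>
      \<Longrightarrow> tmor C (cmp C f' f) (cmp C g' g) = cmp C (tmor C f' g') (tmor C f g)"
    and asc_iso: "\<lbrakk>X \<in> ob C; Y \<in> ob C; Z \<in> ob C\<rbrakk> \<Longrightarrow>
        asc C X Y Z \<in> hom C (tob C (tob C X Y) Z) (tob C X (tob C Y Z)) \<and>
        asc_inv C X Y Z \<in> hom C (tob C X (tob C Y Z)) (tob C (tob C X Y) Z) \<and>
        cmp C (asc_inv C X Y Z) (asc C X Y Z) = idn C (tob C (tob C X Y) Z) \<and>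
        cmp C (asc C X Y Z) (asc_inv C X Y Z) = idn C (tob C X (tob C Y Z))"
    and asc_natural: "\<lbrakk>X \<in> ob C; X' \<in> ob C; Y \<in> ob C; Y' \<in> ob C; Z \<in> ob C; Z' \<in> ob C;
        f \<in> hom C X X'; g \<in> hom C Y Y'; h \<in> hom C Z Z'\<rbrakk>
      \<Longrightarrow> cmp C (asc C X' Y' Z') (tmor C (tmor C f g) h) = cmp C (tmor C f (tmor C g h)) (asc C X Y Z)"
    and pentagon: "\<lbrakk>W \<in> ob C; X \<in> ob C; Y \<in> ob C; Z \<in> ob C\<rbrakk> \<Longrightarrow>
        cmp C (asc C W X (tob C Y Z)) (asc C (tob C W X) Y Z) =
        cmp C (tmor C (idn C W) (asc C X Y Z))
          (cmp C (asc C W (tob C X Y) Z) (tmor C (asc C W X Y) (idn C Z)))"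
    and lun_iso: "X \<in> ob C \<Longrightarrow> iso_mor C (tob C (unt C) X) X (lun C X)"
    and run_iso: "X \<in> ob C \<Longrightarrow> iso_mor C (tob C X (unt C)) X (run C X)"
    and lun_natural: "\<lbrakk>X \<in> ob C; Y \<in> ob C; f \<in> hom C X Y\<rbrakk> \<Longrightarrow>
        cmp C (lun C Y) (tmor C (idn C (unt C)) f) = cmp C f (lun C X)"
    and run_natural: "\<lbrakk>X \<in> ob C; Y \<in> ob C; f \<in> hom C X Y\<rbrakk> \<Longrightarrow>
        cmp C (run C Y) (tmor C f (idn C (unt C))) = cmp C f (run C X)"
    and triangle: "\<lbrakk>X \<in> ob C; Y \<in> ob C\<rbrakk> \<Longrightarrow>
        cmp C (tmor C (idn C X) (lun C Y)) (asc C X (unt C) Y) = tmor C (run C X) (idn C Y)"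

definition braiding :: "('o, 'm) monoidal_structure \<Rightarrow> ('o \<Rightarrow> 'o \<Rightarrow> 'm) \<Rightarrow> bool" where
  "braiding C c \<longleftrightarrow>
     (\<forall>X\<in>ob C. \<forall>Y\<in>ob C. iso_mor C (tob C X Y) (tob C Y X) (c X Y)) \<and>
     (\<forall>X\<in>ob C. \<forall>X'\<in>ob C. \<forall>Y\<in>ob C. \<forall>Y'\<in>ob C. \<forall>f\<in>hom C X X'. \<forall>g\<in>hom C Y Y'.
        cmp C (c X' Y') (tmor C f g) = cmp C (tmor C g f) (c X Y)) \<and>
     (\<forall>X\<in>ob C. \<forall>Y\<in>ob C. \<forall>Z\<in>ob C.
        cmp C (asc C Y Z X) (cmp C (c X (tob C Y Z)) (asc C X Y Z)) =
        cmp C (tmor C (idn C Y) (c X Z)) (cmp C (asc C Y X Z) (tmor C (c X Y) (idn C Z)))) \<and>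
     (\<forall>X\<in>ob C. \<forall>Y\<in>ob C. \<forall>Z\<in>ob C.
        cmp C (asc_inv C Z X Y) (cmp C (c (tob C X Y) Z) (asc_inv C X Y Z)) =
        cmp C (tmor C (c X Z) (idn C Y)) (cmp C (asc_inv C X Z Y) (tmor C (idn C X) (c Y Z))))"

definition braidable :: "('o, 'm) monoidal_structure \<Rightarrow> bool" where
  "braidable C \<longleftrightarrow> (\<exists>c. braiding C c)"


section \<open>The category of finite-dimensional representations\<close>

text \<open>A finite-dimensional representation is given on some \<open>\<complex>\<^sup>n\<close>, as the pair of \<open>n\<close> and the map
  sending an algebra element to the matrix of its action. The basis vector \<open>e\<^sub>i \<otimes> e\<^sub>j\<close> of
  \<open>\<complex>\<^sup>m \<otimes> \<complex>\<^sup>n = \<complex>\<^sup>m\<^sup>n\<close> has index \<open>i * n + j\<close>; then \<open>(e\<^sub>i \<otimes> e\<^sub>j) \<otimes> e\<^sub>k\<close> and \<open>e\<^sub>i \<otimes> (e\<^sub>j \<otimes> e\<^sub>k)\<close>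
  have the same index, so the trivial associator is an identity matrix.\<close>

type_synonym 'a matrep = "nat \<times> ('a \<Rightarrow> complex mat)"

definition is_matrep :: "'a::complex_algebra matrep \<Rightarrow> bool" where
  "is_matrep V \<longleftrightarrow>
     (\<forall>x. snd V x \<in> carrier_mat (fst V) (fst V)) \<and>
     (\<forall>x y. snd V (x + y) = snd V x + snd V y) \<and>
     (\<forall>c x. snd V (c *\<^sub>C x) = c \<cdot>\<^sub>m snd V x) \<and>
     snd V 1 = 1\<^sub>m (fst V) \<and>
     (\<forall>x y. snd V (x * y) = snd V x * snd V y)"

definition intertwiners :: "'a matrep \<Rightarrow> 'a matrep \<Rightarrow> complex mat set" where
  "intertwiners V W = {f \<in> carrier_mat (fst W) (fst V). \<forall>x. f * snd V x = snd W x * f}"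

definition kron :: "complex mat \<Rightarrow> complex mat \<Rightarrow> complex mat" where
  "kron A B = mat (dim_row A * dim_row B) (dim_col A * dim_col B)
     (\<lambda>(i, j). A $$ (i div dim_row B, j div dim_col B) * B $$ (i mod dim_row B, j mod dim_col B))"

text \<open>The representation of \<open>A \<otimes> B\<close> in which \<open>a \<otimes> b\<close> acts by the Kronecker product of the actions
  of \<open>a\<close> and \<open>b\<close>.\<close>

definition outer_rep ::
  "'a::complex_algebra matrep \<Rightarrow> 'b::complex_algebra matrep \<Rightarrow> ('a, 'b) tensor matrep" where
  "outer_rep V W = (fst V * fst W, \<lambda>t. mat (fst V * fst W) (fst V * fst W)
     (\<lambda>(i, j). tensor_lift (\<lambda>a b. kron (snd V a) (snd W b) $$ (i, j)) t))"

definition pullback_rep :: "('a \<Rightarrow> 'b) \<Rightarrow> 'b matrep \<Rightarrow> 'a matrep" where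
  "pullback_rep f V = (fst V, \<lambda>x. snd V (f x))"

definition tensor_rep ::
  "('a::complex_algebra \<Rightarrow> ('a, 'a) tensor) \<Rightarrow> 'a matrep \<Rightarrow> 'a matrep \<Rightarrow> 'a matrep" where
  "tensor_rep \<Delta> V W = pullback_rep \<Delta> (outer_rep V W)"

definition unit_rep :: "('a \<Rightarrow> complex) \<Rightarrow> 'a matrep" where
  "unit_rep \<epsilon> = (1, \<lambda>x. mat 1 1 (\<lambda>_. \<epsilon> x))"

definition rep_category ::
  "('a::complex_algebra \<Rightarrow> ('a, 'a) tensor) \<Rightarrow> ('a \<Rightarrow> complex) \<Rightarrow>
    ('a matrep, complex mat) monoidal_structure" where
  "rep_category \<Delta> \<epsilon> = \<lparr>
     ob = {V. is_matrep V},
     hom = intertwiners,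
     cmp = (*),
     idn = (\<lambda>V. 1\<^sub>m (fst V)),
     tob = tensor_rep \<Delta>,
     tmor = kron,
     unt = unit_rep \<epsilon>,
     asc = (\<lambda>U V W. 1\<^sub>m (fst U * fst V * fst W)),
     asc_inv = (\<lambda>U V W. 1\<^sub>m (fst U * fst V * fst W)),
     lun = (\<lambda>V. 1\<^sub>m (fst V)),
     run = (\<lambda>V. 1\<^sub>m (fst V))\<rparr>"

lemma kron_dim [simp]: "dim_row (kron A B) = dim_row A * dim_row B" "dim_col (kron A B) = dim_col A * dim_col B"
  by (auto simp: kron_def)

lemma kron_carrier [simp]:
  "A \<in> carrier_mat m n \<Longrightarrow> B \<in> carrier_mat p q \<Longrightarrow> kron A B \<in> carrier_mat (m * p) (n * q)"
  by (auto simp: kron_def)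

lemma div_mod_less: "i < m * n \<Longrightarrow> i div n < m \<and> i mod n < n" for i m n :: nat
  by (cases "n = 0") (auto simp: less_mult_imp_div_less)

lemma kron_index:
  "i < dim_row A * dim_row B \<Longrightarrow> j < dim_col A * dim_col B \<Longrightarrow>
    kron A B $$ (i, j) = A $$ (i div dim_row B, j div dim_col B) * B $$ (i mod dim_row B, j mod dim_col B)"
  by (simp add: kron_def)

lemma sum_div_mod: "(\<Sum>k<n * s. f (k div s) (k mod s)) = (\<Sum>i<n. \<Sum>j<s. f i j)"
  for f :: "nat \<Rightarrow> nat \<Rightarrow> 'a::comm_monoid_add" and n s :: nat
proof -
  have "(\<Sum>i<n. \<Sum>j<s. f i j) = (\<Sum>p\<in>{..<n} \<times> {..<s}. f (fst p) (snd p))"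
    by (simp add: sum.cartesian_product case_prod_beta)
  also have "\<dots> = (\<Sum>k<n * s. f (k div s) (k mod s))"
  proof (rule sum.reindex_bij_witness[of _ "\<lambda>k. (k div s, k mod s)" "\<lambda>p. fst p * s + snd p"])
    fix p assume p: "p \<in> {..<n} \<times> {..<s}"
    then have "fst p * s + snd p < Suc (fst p) * s" by auto
    also have "\<dots> \<le> n * s" using p by (intro mult_right_mono) auto
    finally show "fst p * s + snd p \<in> {..<n * s}" by simp
  qed (auto dest: div_mod_less)
  finally show ?thesis by simp
qed

lemma kron_mult:
  assumes "A \<in> carrier_mat m n" "A' \<in> carrier_mat n p" "B \<in> carrier_mat q s" "B' \<in> carrier_mat s r"
  shows "kron A B * kron A' B' = kron (A * A') (B * B')"
proof (rule eq_matI)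
  have d: "dim_row A = m" "dim_col A = n" "dim_row A' = n" "dim_col A' = p"
    "dim_row B = q" "dim_col B = s" "dim_row B' = s" "dim_col B' = r" using assms by auto
  fix i j assume "i < dim_row (kron (A * A') (B * B'))" "j < dim_col (kron (A * A') (B * B'))"
  then have ij: "i < m * q" "j < p * r" by (auto simp: d)
  note ij' = div_mod_less[OF ij(1)] div_mod_less[OF ij(2)]
  have "(kron A B * kron A' B') $$ (i, j) = (\<Sum>k<n * s. kron A B $$ (i, k) * kron A' B' $$ (k, j))"
    using ij by (simp add: d scalar_prod_def atLeast0LessThan)
  also have "\<dots> = (\<Sum>k<n * s. (\<lambda>x y. A $$ (i div q, x) * A' $$ (x, j div r) *
      (B $$ (i mod q, y) * B' $$ (y, j mod r))) (k div s) (k mod s))"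
    using ij by (intro sum.cong) (auto simp: kron_index d)
  also have "\<dots> = (\<Sum>x<n. \<Sum>y<s. A $$ (i div q, x) * A' $$ (x, j div r) *
      (B $$ (i mod q, y) * B' $$ (y, j mod r)))"
    by (rule sum_div_mod)
  also have "\<dots> = kron (A * A') (B * B') $$ (i, j)"
    using ij ij' by (simp add: kron_index d scalar_prod_def atLeast0LessThan sum_product)
  finally show "(kron A B * kron A' B') $$ (i, j) = kron (A * A') (B * B') $$ (i, j)" .
qed auto

lemma kron_one: "kron (1\<^sub>m m) (1\<^sub>m n) = 1\<^sub>m (m * n)"
proof (rule eq_matI)
  fix i j assume "i < dim_row (1\<^sub>m (m * n))" "j < dim_col (1\<^sub>m (m * n))"
  then have ij: "i < m * n" "j < m * n" by auto
  have "i = j" if "i div n = j div n" "i mod n = j mod n"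
    using that by (metis div_mult_mod_eq)
  then show "kron (1\<^sub>m m) (1\<^sub>m n) $$ (i, j) = 1\<^sub>m (m * n) $$ (i, j)"
    using ij div_mod_less[OF ij(1)] div_mod_less[OF ij(2)] by (auto simp: kron_index)
qed auto

lemma kron_assoc: "kron (kron A B) D = kron A (kron B D)"
proof (rule eq_matI)
  fix i j assume "i < dim_row (kron A (kron B D))" "j < dim_col (kron A (kron B D))"
  then have i: "i < dim_row A * (dim_row B * dim_row D)" and j: "j < dim_col A * (dim_col B * dim_col D)"
    by auto
  have *: "k div d < a * b" "k mod (b * d) < b * d" "k div (b * d) = k div d div b"
    "k mod (b * d) div d = k div d mod b" "k mod (b * d) mod d = k mod d"
    if "k < a * (b * d)" for k a b d :: nat
  proof -
    show "k div d < a * b" using div_mod_less[of k "a * b" d] that by (simp add: mult.assoc)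
    show "k mod (b * d) < b * d" using div_mod_less[OF that] by simp
    have "d > 0" using that by (cases "d = 0") auto
    show "k div (b * d) = k div d div b" by (metis div_mult2_eq mult.commute)
    show "k mod (b * d) div d = k div d mod b" "k mod (b * d) mod d = k mod d"
      using \<open>d > 0\<close> by (simp_all add: mod_mult2_eq mult.commute[of b])
  qed
  show "kron (kron A B) D $$ (i, j) = kron A (kron B D) $$ (i, j)"
    using i j *[OF i] *[OF j] by (simp add: kron_index mult.assoc)
qed (auto simp: mult.assoc)

lemma kron_scalar_left: "kron (mat 1 1 (\<lambda>_. c)) B = c \<cdot>\<^sub>m B"
  by (rule eq_matI) (auto simp: kron_def)

lemma kron_scalar_right: "kron B (mat 1 1 (\<lambda>_. c)) = c \<cdot>\<^sub>m B"
  by (rule eq_matI) (auto simp: kron_def)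

lemma kron_bilinear:
  assumes "A \<in> carrier_mat m n" "A' \<in> carrier_mat m n" "B \<in> carrier_mat p q" "B' \<in> carrier_mat p q"
  shows "kron (A + A') B = kron A B + kron A' B" "kron A (B + B') = kron A B + kron A B'"
    "kron (c \<cdot>\<^sub>m A) B = c \<cdot>\<^sub>m kron A B" "kron A (c \<cdot>\<^sub>m B) = c \<cdot>\<^sub>m kron A B"
  using assms by (cases "p = 0 \<or> q = 0";
    auto intro!: eq_matI simp: kron_index distrib_left distrib_right less_mult_imp_div_less)+

lemma is_matrepD:
  assumes "is_matrep V"
  shows "snd V x \<in> carrier_mat (fst V) (fst V)" "snd V (x + y) = snd V x + snd V y"
    "snd V (c *\<^sub>C x) = c \<cdot>\<^sub>m snd V x" "snd V 1 = 1\<^sub>m (fst V)" "snd V (x * y) = snd V x * snd V y"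
    "dim_row (snd V x) = fst V" "dim_col (snd V x) = fst V" "snd V 0 = 0\<^sub>m (fst V) (fst V)"
proof -
  show 1: "snd V x \<in> carrier_mat (fst V) (fst V)" "snd V (x + y) = snd V x + snd V y"
    "snd V (c *\<^sub>C x) = c \<cdot>\<^sub>m snd V x" "snd V 1 = 1\<^sub>m (fst V)" "snd V (x * y) = snd V x * snd V y" for x y c
    using assms by (auto simp: is_matrep_def)
  show "dim_row (snd V x) = fst V" "dim_col (snd V x) = fst V" using 1(1)[of x] by auto
  have "snd V 0 = 0 \<cdot>\<^sub>m snd V 0" using 1(3)[of 0 0] by simp
  then show "snd V 0 = 0\<^sub>m (fst V) (fst V)" using 1(1)[of 0] by (metis (no_types, lifting) carrier_matD eq_matI index_smult_mat(1) index_zero_mat mult_zero_left)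
qed

context
  fixes V :: "'a::complex_algebra matrep" and W :: "'b::complex_algebra matrep"
  assumes V: "is_matrep V" and W: "is_matrep W"
begin

lemma bilinear_kron_entry:
  assumes "i < fst V * fst W" "j < fst V * fst W"
  shows "bilinear_map (\<lambda>a b. kron (snd V a) (snd W b) $$ (i, j))"
proof (rule bilinear_mapI)
  note kb = kron_bilinear[OF is_matrepD(1)[OF V] is_matrepD(1)[OF V] is_matrepD(1)[OF W] is_matrepD(1)[OF W]]
  note d = is_matrepD(6,7)[OF V] is_matrepD(6,7)[OF W]
  fix a a' b b' and c :: complex
  show "kron (snd V (a + a')) (snd W b) $$ (i, j) =
    kron (snd V a) (snd W b) $$ (i, j) + kron (snd V a') (snd W b) $$ (i, j)"
    "kron (snd V a) (snd W (b + b')) $$ (i, j) =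
    kron (snd V a) (snd W b) $$ (i, j) + kron (snd V a) (snd W b') $$ (i, j)"
    "kron (snd V (c *\<^sub>C a)) (snd W b) $$ (i, j) = c *\<^sub>C kron (snd V a) (snd W b) $$ (i, j)"
    "kron (snd V a) (snd W (c *\<^sub>C b)) $$ (i, j) = c *\<^sub>C kron (snd V a) (snd W b) $$ (i, j)"
    using assms by (simp_all add: is_matrepD[OF V] is_matrepD[OF W] kb d scaleC_complex_def)
qed

lemma outer_rep_tens [simp]: "snd (outer_rep V W) (a \<otimes>\<^sub>t b) = kron (snd V a) (snd W b)"
  by (rule eq_matI) (auto simp: outer_rep_def bilinear_kron_entry is_matrepD(6,7)[OF V] is_matrepD(6,7)[OF W])

lemma outer_rep_linear:
  "snd (outer_rep V W) (s + t) = snd (outer_rep V W) s + snd (outer_rep V W) t"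
  "snd (outer_rep V W) (c *\<^sub>C t) = c \<cdot>\<^sub>m snd (outer_rep V W) t"
  "snd (outer_rep V W) 0 = 0\<^sub>m (fst V * fst W) (fst V * fst W)"
  by (auto intro!: eq_matI simp: outer_rep_def bilinear_kron_entry scaleC_complex_def
      clinear_mapD[OF clinear_tensor_lift[OF bilinear_kron_entry]])

lemma outer_rep_carrier: "snd (outer_rep V W) t \<in> carrier_mat (fst V * fst W) (fst V * fst W)"
  by (simp add: outer_rep_def)

lemma fst_outer_rep [simp]: "fst (outer_rep V W) = fst V * fst W"
  by (simp add: outer_rep_def)

lemma outer_rep_mult: "snd (outer_rep V W) (s * t) = snd (outer_rep V W) s * snd (outer_rep V W) t"
proof -
  note c = outer_rep_carrier
  have z: "0 * t = 0" "t * 0 = 0" for t :: "('a, 'b) tensor" by auto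
  show ?thesis
  proof (induction s rule: tensor_induct)
    case zero
    show ?case using left_mult_zero_mat[OF c[of t]] by (simp add: outer_rep_linear)
  next
    case (add s s')
    show ?case using add add_mult_distrib_mat[OF c c c, of s s' t]
      by (simp add: outer_rep_linear distrib_right)
  next
    case (tens a b)
    show ?case
    proof (induction t rule: tensor_induct)
      case zero
      show ?case using right_mult_zero_mat[OF c[of "a \<otimes>\<^sub>t b"]] by (simp add: outer_rep_linear)
    next
      case (add t t')
      show ?case using add mult_add_distrib_mat[OF c c c, of "a \<otimes>\<^sub>t b" t t']
        by (simp only: outer_rep_linear distrib_left)
    next
      case (tens a' b')
      show ?case
        by (simp add: tens_mult is_matrepD[OF V] is_matrepD[OF W]
            kron_mult[OF is_matrepD(1)[OF V] is_matrepD(1)[OF V] is_matrepD(1)[OF W] is_matrepD(1)[OF W]])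
    qed
  qed
qed

lemma is_matrep_outer: "is_matrep (outer_rep V W)"
  unfolding is_matrep_def
  by (simp add: outer_rep_carrier outer_rep_linear outer_rep_mult one_tensor_def
      is_matrepD(4)[OF V] is_matrepD(4)[OF W] kron_one)

end

lemma is_matrep_pullback: "algebra_map f \<Longrightarrow> is_matrep V \<Longrightarrow> is_matrep (pullback_rep f V)"
  by (auto simp: is_matrep_def pullback_rep_def algebra_mapD)

lemma pullback_rep_simps [simp]: "fst (pullback_rep f V) = fst V" "snd (pullback_rep f V) x = snd V (f x)"
  by (auto simp: pullback_rep_def)

lemma pullback_rep_comp: "pullback_rep f (pullback_rep g V) = pullback_rep (\<lambda>x. g (f x)) V"
  by (simp add: pullback_rep_def)

lemma matrep_tensor_eq:
  assumes "is_matrep X" "is_matrep Y" "fst X = fst Y" "\<And>a b. snd X (a \<otimes>\<^sub>t b) = snd Y (a \<otimes>\<^sub>t b)"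
  shows "X = Y"
proof -
  have "snd X t = snd Y t" for t
    by (induction t rule: tensor_induct)
      (auto simp: assms(3,4) is_matrepD(2,8)[OF assms(1)] is_matrepD(2,8)[OF assms(2)])
  then show ?thesis using assms(3) by (simp add: prod_eq_iff ext)
qed

lemma outer_pullback_rep:
  assumes "is_matrep V" "is_matrep W" "algebra_map f" "algebra_map g"
  shows "outer_rep (pullback_rep f V) (pullback_rep g W) = pullback_rep (tensor_map f g) (outer_rep V W)"
  using assms
  by (intro matrep_tensor_eq is_matrep_pullback is_matrep_outer algebra_map_tensor_map)
    (auto simp: is_matrep_pullback algebra_map_def)

lemma outer_rep_assoc:
  assumes U: "is_matrep U" and V: "is_matrep V" and W: "is_matrep W"
  shows "outer_rep (outer_rep U V) W = pullback_rep tensor_assoc (outer_rep U (outer_rep V W))"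
proof (rule matrep_tensor_eq)
  note [simp] = is_matrep_outer assms
  show "is_matrep (outer_rep (outer_rep U V) W)"
    and P: "is_matrep (pullback_rep tensor_assoc (outer_rep U (outer_rep V W)))"
    by (auto intro: is_matrep_pullback)
  show "fst (outer_rep (outer_rep U V) W) = fst (pullback_rep tensor_assoc (outer_rep U (outer_rep V W)))"
    by simp
  fix s c
  note O = is_matrepD[OF is_matrep_outer[OF is_matrep_outer[OF U V] W]]
  show "snd (outer_rep (outer_rep U V) W) (s \<otimes>\<^sub>t c) =
    snd (pullback_rep tensor_assoc (outer_rep U (outer_rep V W))) (s \<otimes>\<^sub>t c)"
  proof (induction s rule: tensor_induct)
    case zero
    show ?case using O(8) is_matrepD(8)[OF P] by (simp add: mult.assoc)
  next
    case (tens a b)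
    show ?case by (simp add: kron_assoc)
  next
    case (add s t)
    then show ?case using O(2)[of "s \<otimes>\<^sub>t c" "t \<otimes>\<^sub>t c"] is_matrepD(2)[OF P, of "s \<otimes>\<^sub>t c" "t \<otimes>\<^sub>t c"]
      by (simp only: tens_add_left)
  qed
qed

lemma outer_rep_intertwiners:
  assumes V: "is_matrep V" "is_matrep V'" and W: "is_matrep W" "is_matrep W'"
    and f: "f \<in> intertwiners V V'" and g: "g \<in> intertwiners W W'"
  shows "kron f g \<in> intertwiners (outer_rep V W) (outer_rep V' W')"
proof -
  let ?X = "snd (outer_rep V W)" and ?Y = "snd (outer_rep V' W')"
  have c: "f \<in> carrier_mat (fst V') (fst V)" "g \<in> carrier_mat (fst W') (fst W)"
    and fg: "\<And>x. f * snd V x = snd V' x * f" "\<And>x. g * snd W x = snd W' x * g"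
    using f g by (auto simp: intertwiners_def)
  have k: "kron f g \<in> carrier_mat (fst V' * fst W') (fst V * fst W)" using c by simp
  note X = outer_rep_carrier[OF V(1) W(1)] and Y = outer_rep_carrier[OF V(2) W(2)]
  have "kron f g * ?X t = ?Y t * kron f g" for t
  proof (induction t rule: tensor_induct)
    case zero
    show ?case using right_mult_zero_mat[OF k] left_mult_zero_mat[OF k] by (simp add: outer_rep_linear V W)
  next
    case (tens a b)
    show ?case
      using kron_mult[OF c(1) is_matrepD(1)[OF V(1)] c(2) is_matrepD(1)[OF W(1)]]
        kron_mult[OF is_matrepD(1)[OF V(2)] c(1) is_matrepD(1)[OF W(2)] c(2)]
      by (simp add: V W fg)
  next
    case (add s t)
    then show ?case using mult_add_distrib_mat[OF k X X, of s t] add_mult_distrib_mat[OF Y Y k, of s t]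
      by (simp add: outer_rep_linear V W)
  qed
  then show ?thesis using k V W by (simp add: intertwiners_def)
qed

theorem monoidal_category_rep:
  assumes "hopf_algebra \<Delta> \<epsilon> S"
  shows "monoidal_category (rep_category \<Delta> \<epsilon>)"
proof -
  have D: "algebra_map \<Delta>" and e: "algebra_map \<epsilon>"
    and coassoc: "\<And>x. tensor_assoc (tensor_map \<Delta> id (\<Delta> x)) = tensor_map id \<Delta> (\<Delta> x)"
    and counit: "\<And>x. tensor_lift (\<lambda>a b. \<epsilon> a *\<^sub>C b) (\<Delta> x) = x"
      "\<And>x. tensor_lift (\<lambda>a b. \<epsilon> b *\<^sub>C a) (\<Delta> x) = x"
    using assms by (auto simp: hopf_algebra_def)
  have T: "is_matrep (tensor_rep \<Delta> V W)" if "is_matrep V" "is_matrep W" for V W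
    unfolding tensor_rep_def using that D by (intro is_matrep_pullback is_matrep_outer)
  have fT [simp]: "fst (tensor_rep \<Delta> V W) = fst V * fst W" for V W
    by (simp add: tensor_rep_def outer_rep_def)
  have assoc: "tensor_rep \<Delta> (tensor_rep \<Delta> U V) W = tensor_rep \<Delta> U (tensor_rep \<Delta> V W)"
    if "is_matrep U" "is_matrep V" "is_matrep W" for U V W
  proof -
    have i: "pullback_rep id V = V" for V :: "'a matrep" by (simp add: pullback_rep_def)
    have "tensor_rep \<Delta> (tensor_rep \<Delta> U V) W =
      pullback_rep \<Delta> (outer_rep (pullback_rep \<Delta> (outer_rep U V)) (pullback_rep id W))"
      by (simp add: tensor_rep_def i)
    also have "\<dots> = pullback_rep (\<lambda>x. tensor_assoc (tensor_map \<Delta> id (\<Delta> x))) (outer_rep U (outer_rep V W))"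
      using that D by (simp add: outer_pullback_rep is_matrep_outer outer_rep_assoc pullback_rep_comp)
    also have "\<dots> = pullback_rep \<Delta> (outer_rep (pullback_rep id U) (pullback_rep \<Delta> (outer_rep V W)))"
      using that D by (simp add: coassoc outer_pullback_rep[OF _ is_matrep_outer algebra_map_id(2) D]
          pullback_rep_comp)
    finally show ?thesis by (simp add: tensor_rep_def i)
  qed
  have u: "is_matrep (unit_rep \<epsilon>)"
    unfolding is_matrep_def unit_rep_def using algebra_mapD[OF e]
    by (auto intro!: eq_matI simp: scaleC_complex_def scalar_prod_def)
  have lu: "tensor_rep \<Delta> (unit_rep \<epsilon>) V = V" if V: "is_matrep V" for V
  proof -
    have "outer_rep (unit_rep \<epsilon>) V = pullback_rep (tensor_lift (\<lambda>a b. \<epsilon> a *\<^sub>C b)) V"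
      using V u e by (intro matrep_tensor_eq is_matrep_outer is_matrep_pullback algebra_map_counit_left)
        (auto simp: bilinear_scale_left algebra_mapD(8)[OF e] is_matrepD[OF V],
         auto simp: unit_rep_def kron_scalar_left[unfolded One_nat_def])
    then show ?thesis by (simp add: tensor_rep_def pullback_rep_comp counit) (simp add: pullback_rep_def)
  qed
  have ru: "tensor_rep \<Delta> V (unit_rep \<epsilon>) = V" if V: "is_matrep V" for V
  proof -
    have "outer_rep V (unit_rep \<epsilon>) = pullback_rep (tensor_lift (\<lambda>a b. \<epsilon> b *\<^sub>C a)) V"
      using V u e by (intro matrep_tensor_eq is_matrep_outer is_matrep_pullback algebra_map_counit_right)
        (auto simp: bilinear_scale_right algebra_mapD(8)[OF e] is_matrepD[OF V],
         auto simp: unit_rep_def kron_scalar_right[unfolded One_nat_def])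
    then show ?thesis by (simp add: tensor_rep_def pullback_rep_comp counit) (simp add: pullback_rep_def)
  qed
  have tm: "kron f g \<in> intertwiners (tensor_rep \<Delta> V W) (tensor_rep \<Delta> V' W')"
    if "is_matrep V" "is_matrep V'" "is_matrep W" "is_matrep W'" "f \<in> intertwiners V V'" "g \<in> intertwiners W W'"
    for V V' W W' f g
    using outer_rep_intertwiners[OF that] by (simp add: intertwiners_def tensor_rep_def)
  have one: "1\<^sub>m (fst V) \<in> intertwiners V V" if "is_matrep V" for V :: "'a matrep"
    using left_mult_one_mat[OF is_matrepD(1)[OF that]] right_mult_one_mat[OF is_matrepD(1)[OF that]]
    by (simp add: intertwiners_def)
  have one': "1\<^sub>m n \<in> intertwiners V V" if "is_matrep V" "n = fst V" for V :: "'a matrep" and n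
    using one that by simp
  have comp: "g * f \<in> intertwiners X Z"
    if "is_matrep X" "is_matrep Y" "is_matrep Z" "f \<in> intertwiners X Y" "g \<in> intertwiners Y Z"
    for X Y Z :: "'a matrep" and f g
  proof -
    have c: "f \<in> carrier_mat (fst Y) (fst X)" "g \<in> carrier_mat (fst Z) (fst Y)"
      and fg: "\<And>x. f * snd X x = snd Y x * f" "\<And>x. g * snd Y x = snd Z x * g"
      using that by (auto simp: intertwiners_def)
    have "g * f * snd X x = snd Z x * (g * f)" for x
    proof -
      have "g * f * snd X x = g * (snd Y x * f)"
        using c is_matrepD(1)[OF that(1), of x] by (simp add: fg flip: fg(1))
      also have "\<dots> = (g * snd Y x) * f"
        using c is_matrepD(1)[OF that(2), of x] by (simp add: assoc_mult_mat)
      also have "\<dots> = snd Z x * (g * f)"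
        using c is_matrepD(1)[OF that(3), of x] by (simp add: fg assoc_mult_mat)
      finally show ?thesis .
    qed
    then show ?thesis using c by (simp add: intertwiners_def)
  qed
  have car: "f \<in> carrier_mat (fst Y) (fst X)" if "f \<in> intertwiners X Y" for X Y :: "'a matrep" and f
    using that by (simp add: intertwiners_def)
  have k1: "kron (1\<^sub>m 1) f = f" "kron f (1\<^sub>m 1) = f" for f
    by (auto intro!: eq_matI simp: kron_def)
  have fu [simp]: "fst (unit_rep \<epsilon>) = 1" by (simp add: unit_rep_def)
  note [simp] = T u assoc lu ru kron_one
  show ?thesis
  proof (unfold_locales, goal_cases)
    case 1 then show ?case by (auto simp: rep_category_def intro: comp)
  next
    case 2 then show ?case by (auto simp: rep_category_def intro: one)
  next
    case 3 then show ?case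
      by (simp add: rep_category_def assoc_mult_mat[OF car car car, symmetric])
  next
    case 4 then show ?case using car by (fastforce simp: rep_category_def)
  next
    case 5 then show ?case by (simp add: rep_category_def)
  next
    case 6 then show ?case by (simp add: rep_category_def)
  next
    case 7 then show ?case by (auto simp: rep_category_def intro: tm)
  next
    case 8 then show ?case by (simp add: rep_category_def)
  next
    case 9 then show ?case
      by (simp add: rep_category_def kron_mult[OF car car car car])
  next
    case 10 then show ?case
      by (auto simp: rep_category_def mult.assoc intro!: one')
  next
    case (11 X X' Y Y' Z Z' f g h)
    then have k: "kron f (kron g h) \<in> carrier_mat (fst X' * (fst Y' * fst Z')) (fst X * (fst Y * fst Z))"
      by (auto simp: rep_category_def intro!: kron_carrier car)
    show ?case using left_mult_one_mat[OF k] right_mult_one_mat[OF k]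
      by (simp add: rep_category_def kron_assoc mult.assoc)
  next
    case 12 then show ?case by (simp add: rep_category_def mult.assoc)
  next
    case 13 then show ?case
      by (auto simp: rep_category_def iso_mor_def intro!: one bexI[of _ "1\<^sub>m _"])
  next
    case 14 then show ?case
      by (auto simp: rep_category_def iso_mor_def intro!: one bexI[of _ "1\<^sub>m _"])
  next
    case 15 then show ?case using car by (fastforce simp: rep_category_def k1[unfolded One_nat_def])
  next
    case 16 then show ?case using car by (fastforce simp: rep_category_def k1[unfolded One_nat_def])
  next
    case 17 then show ?case by (simp add: rep_category_def)
  qed
qed

corollary monoidal_category_rep_Q: "monoidal_category (rep_category Q_comult Q_counit)"
  by (rule monoidal_category_rep[OF hopf_algebra_Q])

end

theory Submission
  imports Defs
begin

text \<open>Let \<open>\<chi>\<close> be the character with \<open>\<chi>(K) = -1\<close> and \<open>X\<close> the simple module with basis \<open>v\<^sub>0, v\<^sub>1\<close> on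
  which \<open>K\<close> has eigenvalues \<open>\<i>, -\<i>\<close>. The braiding \<open>\<chi> \<otimes> X \<rightarrow> X \<otimes> \<chi>\<close> is a \<open>2 \<times> 2\<close> matrix \<open>U\<close> that
  anticommutes with the action of \<open>E\<close>, since \<open>E\<close> acts on the two sides by \<open>E\<close> and \<open>-E\<close>. As
  \<open>\<chi> \<otimes> \<chi>\<close> is the unit, a hexagon gives \<open>U\<^sup>2 = 1\<close>; the other hexagon says that \<open>\<chi>\<close> braids past
  \<open>X \<otimes> X\<close> by \<open>U \<otimes> U\<close>, which by naturality fixes the invariant vector \<open>v\<^sub>0 \<otimes> v\<^sub>1 + \<i> v\<^sub>1 \<otimes> v\<^sub>0\<close>. But \<open>E\<close>
  maps \<open>v\<^sub>1\<close> to \<open>v\<^sub>0\<close>, so \<open>U\<close> has opposite diagonal entries \<open>\<plusminus>1\<close> and \<open>U \<otimes> U\<close> changes the sign of the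
  \<open>v\<^sub>0 \<otimes> v\<^sub>1\<close> coordinate. For an R-matrix, the same argument applies to the action on \<open>X\<close> of the
  group-like element \<open>(\<chi> \<otimes> id)(R)\<close>.\<close>

section \<open>Slicing by characters and one-dimensional representations\<close>

text \<open>A character removes the first tensor factor by an algebra map. The second factor has its
  own type because \<open>A \<otimes> (A \<otimes> A)\<close> is sliced as well.\<close>

lemma left_slice:
  fixes \<chi> :: "'a::complex_algebra \<Rightarrow> complex"
  assumes "algebra_map \<chi>"
  shows "tensor_lift (\<lambda>a (b :: 'b::complex_algebra). \<chi> a *\<^sub>C b) (a \<otimes>\<^sub>t b) = \<chi> a *\<^sub>C b"
    "tensor_lift (\<lambda>a (b :: 'b). \<chi> a *\<^sub>C b) (s + t) =
      tensor_lift (\<lambda>a b. \<chi> a *\<^sub>C b) s + tensor_lift (\<lambda>a b. \<chi> a *\<^sub>C b) t"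
    "tensor_lift (\<lambda>a (b :: 'b). \<chi> a *\<^sub>C b) (s * t) =
      tensor_lift (\<lambda>a b. \<chi> a *\<^sub>C b) s * tensor_lift (\<lambda>a b. \<chi> a *\<^sub>C b) t"
    "tensor_lift (\<lambda>a (b :: 'b). \<chi> a *\<^sub>C b) 0 = 0"
    "tensor_lift (\<lambda>a (b :: 'b). \<chi> a *\<^sub>C b) 1 = 1"
  by (simp_all add: algebra_mapD[OF algebra_map_counit_left[OF assms]]
      tensor_lift_tens[OF bilinear_scale_left[OF algebra_mapD(8)[OF assms]]])

lemma algebra_map_slice_comult:
  fixes \<chi> :: "'a::complex_algebra \<Rightarrow> complex" and \<Delta> :: "'a \<Rightarrow> ('a, 'a) tensor"
  assumes "algebra_map \<chi>" "algebra_map \<Delta>"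
  shows "algebra_map (\<lambda>x. tensor_lift (\<lambda>a b. \<chi> a *\<^sub>C b) (\<Delta> x))"
    "algebra_map (\<lambda>x. tensor_lift (\<lambda>a b. \<chi> b *\<^sub>C a) (\<Delta> x))"
  using assms by (auto intro: algebra_map_comp algebra_map_counit_left algebra_map_counit_right)

lemma pullback_rep_ident [simp]: "pullback_rep (\<lambda>x. x) V = V"
  by (simp add: pullback_rep_def)

lemma is_matrep_unit_rep: "algebra_map \<chi> \<Longrightarrow> is_matrep (unit_rep \<chi>)"
  unfolding is_matrep_def unit_rep_def using algebra_mapD[of \<chi>]
  by (auto intro!: eq_matI simp: scaleC_complex_def scalar_prod_def)

lemma fst_unit_rep [simp]: "fst (unit_rep \<chi>) = 1"
  by (simp add: unit_rep_def)

text \<open>A Kronecker product with a one-by-one matrix only rescales, so tensoring with a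
  character keeps the space and twists the action. Being an equality and not merely an isomorphism,
  this can be substituted directly into the braiding axioms.\<close>

lemma tensor_rep_character_left:
  fixes V :: "'a::complex_algebra matrep"
  assumes "algebra_map \<chi>" "is_matrep V"
  shows "tensor_rep \<Delta> (unit_rep \<chi>) V = pullback_rep (\<lambda>x. tensor_lift (\<lambda>a b. \<chi> a *\<^sub>C b) (\<Delta> x)) V"
proof -
  have "outer_rep (unit_rep \<chi>) V = pullback_rep (tensor_lift (\<lambda>a b. \<chi> a *\<^sub>C b)) V"
    using assms is_matrep_unit_rep[OF assms(1)]
    by (intro matrep_tensor_eq is_matrep_outer is_matrep_pullback algebra_map_counit_left)
      (auto simp: left_slice is_matrepD[OF assms(2)],
       auto simp: unit_rep_def kron_scalar_left[unfolded One_nat_def])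
  then show ?thesis by (simp add: tensor_rep_def pullback_rep_comp)
qed

lemma tensor_rep_character_right:
  fixes V :: "'a::complex_algebra matrep"
  assumes "algebra_map \<chi>" "is_matrep V"
  shows "tensor_rep \<Delta> V (unit_rep \<chi>) = pullback_rep (\<lambda>x. tensor_lift (\<lambda>a b. \<chi> b *\<^sub>C a) (\<Delta> x)) V"
proof -
  have "outer_rep V (unit_rep \<chi>) = pullback_rep (tensor_lift (\<lambda>a b. \<chi> b *\<^sub>C a)) V"
    using assms is_matrep_unit_rep[OF assms(1)]
    by (intro matrep_tensor_eq is_matrep_outer is_matrep_pullback algebra_map_counit_right)
      (auto simp: tensor_lift_tens[OF bilinear_scale_right[OF algebra_mapD(8)[OF assms(1)]]]
        is_matrepD[OF assms(2)],
       auto simp: unit_rep_def kron_scalar_right[unfolded One_nat_def])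
  then show ?thesis by (simp add: tensor_rep_def pullback_rep_comp)
qed

lemma is_matrep_tensor_rep:
  "algebra_map \<Delta> \<Longrightarrow> is_matrep V \<Longrightarrow> is_matrep W \<Longrightarrow> is_matrep (tensor_rep \<Delta> V W)"
  unfolding tensor_rep_def by (intro is_matrep_pullback is_matrep_outer)

lemma fst_tensor_rep [simp]: "fst (tensor_rep \<Delta> V W) = fst V * fst W"
  by (simp add: tensor_rep_def outer_rep_def)

lemma kron_one_1 [simp]: "kron (1\<^sub>m 1) f = f" "kron f (1\<^sub>m 1) = f"
  by (auto intro!: eq_matI simp: kron_def)

text \<open>The elements whose actions are intertwined by \<open>f\<close> form a unital subalgebra,
  so the generators suffice.\<close>

lemma Q_intertwinersI:
  fixes V W :: "uisl2 matrep"
  assumes V: "is_matrep V" and W: "is_matrep W" and f: "f \<in> carrier_mat (fst W) (fst V)"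
    and gen: "\<And>g. f * snd V (Q_gen g) = snd W (Q_gen g) * f"
  shows "f \<in> intertwiners V W"
proof -
  note V' = is_matrepD(1)[OF V] and W' = is_matrepD(1)[OF W]
  have "f * snd V x = snd W x * f" for x
  proof (induction x rule: Q_induct)
    case one
    then show ?case using f by (simp add: is_matrepD[OF V] is_matrepD[OF W])
  next
    case (add x y)
    then show ?case
      by (simp add: is_matrepD(2)[OF V] is_matrepD(2)[OF W] mult_add_distrib_mat[OF f V' V']
          add_mult_distrib_mat[OF W' W' f])
  next
    case (scale c x)
    then show ?case
      by (simp add: is_matrepD(3)[OF V] is_matrepD(3)[OF W] mult_smult_distrib[OF f V']
          mult_smult_assoc_mat[OF W' f])
  next
    case (mult x y)
    have "f * (snd V x * snd V y) = (snd W x * f) * snd V y"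
      by (simp add: assoc_mult_mat[OF f V' V', symmetric] mult)
    also have "\<dots> = snd W x * snd W y * f"
      by (simp add: assoc_mult_mat[OF W' f V'] mult assoc_mult_mat[OF W' W' f])
    finally show ?case by (simp add: is_matrepD(5)[OF V] is_matrepD(5)[OF W])
  qed (rule gen)
  then show ?thesis using f by (simp add: intertwiners_def)
qed


section \<open>A character and a simple module\<close>

definition Q_sign :: "uisl2 \<Rightarrow> complex" where
  "Q_sign = Q_lift (\<lambda>g. case g of gen_E \<Rightarrow> 0 | gen_F \<Rightarrow> 0 | gen_K \<Rightarrow> - 1 | gen_Kinv \<Rightarrow> - 1)"

lemma Q_relations_sign:
  "Q_relations (\<lambda>g. case g of gen_E \<Rightarrow> 0 | gen_F \<Rightarrow> 0 | gen_K \<Rightarrow> - 1 | gen_Kinv \<Rightarrow> (- 1 :: complex))"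
  by (simp add: Q_relations_def Let_def scaleC_complex_def)

lemma algebra_map_Q_sign: "algebra_map Q_sign"
  unfolding Q_sign_def by (rule algebra_map_Q_lift[OF Q_relations_sign])

lemma Q_sign_gen: "Q_sign Q_E = 0" "Q_sign Q_F = 0" "Q_sign Q_K = - 1" "Q_sign Q_Kinv = - 1"
  by (simp_all add: Q_sign_def Q_relations_sign)

text \<open>The character has order two under convolution; this yields \<chi> \<otimes> \<chi> = 1
  for representations and \<open>u * u = 1\<close> for the slice of an R-matrix.\<close>

lemma Q_sign_comult:
  "Q_sign (tensor_lift (\<lambda>a b. Q_sign a *\<^sub>C b) (Q_comult x)) = Q_counit x"
proof (rule algebra_map_eq_Q[of _ _ x])
  show "algebra_map (\<lambda>x. Q_sign (tensor_lift (\<lambda>a b. Q_sign a *\<^sub>C b) (Q_comult x)))"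
    by (intro algebra_map_comp[OF algebra_map_Q_sign] algebra_map_slice_comult
        algebra_map_Q_sign algebra_map_Q_comult)
  show "Q_sign (tensor_lift (\<lambda>a b. Q_sign a *\<^sub>C b) (Q_comult (Q_gen h))) = Q_counit (Q_gen h)" for h
    by (cases h) (simp_all add: Q_comult_gen Q_counit_gen Q_sign_gen scaleC_complex_def
        left_slice[OF algebra_map_Q_sign] algebra_mapD[OF algebra_map_Q_sign])
qed (rule algebra_map_Q_counit)

text \<open>Matrices over \<open>\<complex>\<close> do not form an algebra type, which \<^const>\<open>Q_lift\<close> needs as its target.\<close>

datatype mat2 = Mat2 complex complex complex complex

instantiation mat2 :: complex_algebra
begin
definition "0 = Mat2 0 0 0 0"
definition "1 = Mat2 1 0 0 1"
fun plus_mat2 where "Mat2 a b c d + Mat2 a' b' c' d' = Mat2 (a + a') (b + b') (c + c') (d + d')"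
fun minus_mat2 where "Mat2 a b c d - Mat2 a' b' c' d' = Mat2 (a - a') (b - b') (c - c') (d - d')"
fun uminus_mat2 where "- Mat2 a b c d = Mat2 (- a) (- b) (- c) (- d)"
fun times_mat2 where "Mat2 a b c d * Mat2 a' b' c' d' =
  Mat2 (a * a' + b * c') (a * b' + b * d') (c * a' + d * c') (c * b' + d * d')"
fun scaleC_mat2 where "scaleC_mat2 k (Mat2 a b c d) = Mat2 (k * a) (k * b) (k * c) (k * d)"
instance
proof
  fix x y z :: mat2 and k l :: complex
  note [simp] = zero_mat2_def one_mat2_def algebra_simps
  show "x + y + z = x + (y + z)" "x * y * z = x * (y * z)" "(x + y) * z = x * z + y * z"
    "x * (y + z) = x * y + x * z"
    by (cases x; cases y; cases z; simp)+
  show "x + y = y + x" "x - y = x + - y" "(k *\<^sub>C x) * y = k *\<^sub>C (x * y)" "x * k *\<^sub>C y = k *\<^sub>C (x * y)"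
    "k *\<^sub>C (x + y) = k *\<^sub>C x + k *\<^sub>C y"
    by (cases x; cases y; simp)+
  show "0 + x = x" "- x + x = 0" "1 * x = x" "x * 1 = x" "(k + l) *\<^sub>C x = k *\<^sub>C x + l *\<^sub>C x"
    "k *\<^sub>C l *\<^sub>C x = (k * l) *\<^sub>C x" "1 *\<^sub>C x = x"
    by (cases x; simp)+
qed
end

fun mat_of_mat2 :: "mat2 \<Rightarrow> complex mat" where
  "mat_of_mat2 (Mat2 a b c d) =
    mat 2 2 (\<lambda>(i, j). if i = 0 then (if j = 0 then a else b) else (if j = 0 then c else d))"

lemma is_matrep_mat2: "is_matrep (2, mat_of_mat2)"
proof -
  have "mat_of_mat2 x \<in> carrier_mat 2 2" for x by (cases x) simp
  moreover have "mat_of_mat2 (x + y) = mat_of_mat2 x + mat_of_mat2 y" for x y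
    by (cases x; cases y) (auto intro!: eq_matI)
  moreover have "mat_of_mat2 (c *\<^sub>C x) = c \<cdot>\<^sub>m mat_of_mat2 x" for c x
    by (cases x) (auto intro!: eq_matI)
  moreover have "mat_of_mat2 1 = 1\<^sub>m 2"
    by (auto intro!: eq_matI simp: one_mat2_def)
  moreover have "mat_of_mat2 (x * y) = mat_of_mat2 x * mat_of_mat2 y" for x y
    by (cases x; cases y) (auto intro!: eq_matI simp: scalar_prod_def numeral_2_eq_2)
  ultimately show ?thesis by (simp add: is_matrep_def)
qed

definition Q_fund :: "uisl2 matrep" where
  "Q_fund = pullback_rep (Q_lift (\<lambda>g. case g of gen_E \<Rightarrow> Mat2 0 1 0 0 | gen_F \<Rightarrow> Mat2 0 0 1 0
     | gen_K \<Rightarrow> Mat2 \<i> 0 0 (- \<i>) | gen_Kinv \<Rightarrow> Mat2 (- \<i>) 0 0 \<i>)) (2, mat_of_mat2)"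

text \<open>With eigenvalues \<open>\<i>\<close> and \<open>- \<i>\<close> of K, the element
  \<open>(K - Kinv) / (2 * \<i>)\<close> acts by diag(1, -1), the commutator of the two matrix
  units.\<close>

lemma Q_relations_fund:
  "Q_relations (\<lambda>g. case g of gen_E \<Rightarrow> Mat2 0 1 0 0 | gen_F \<Rightarrow> Mat2 0 0 1 0
     | gen_K \<Rightarrow> Mat2 \<i> 0 0 (- \<i>) | gen_Kinv \<Rightarrow> Mat2 (- \<i>) 0 0 \<i>)"
  by (simp add: Q_relations_def Let_def zero_mat2_def one_mat2_def numeral_eq_Suc)

lemma is_matrep_Q_fund: "is_matrep Q_fund"
  unfolding Q_fund_def
  by (intro is_matrep_pullback is_matrep_mat2 algebra_map_Q_lift Q_relations_fund)

lemma fst_Q_fund [simp]: "fst Q_fund = 2"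
  by (simp add: Q_fund_def)

lemma Q_fund_gen:
  "snd Q_fund Q_E = mat_of_mat2 (Mat2 0 1 0 0)" "snd Q_fund Q_F = mat_of_mat2 (Mat2 0 0 1 0)"
  "snd Q_fund Q_K = mat_of_mat2 (Mat2 \<i> 0 0 (- \<i>))"
  "snd Q_fund Q_Kinv = mat_of_mat2 (Mat2 (- \<i>) 0 0 \<i>)"
  by (simp_all add: Q_fund_def Q_relations_fund del: mat_of_mat2.simps)

text \<open>Rows are indexed by \<open>2 * i + j\<close> for
  \<open>v\<^sub>i \<otimes> v\<^sub>j\<close>. The vector is written as a single column so that it
  can be a morphism from the unit object.\<close>

definition Q_fund_invariant :: "complex mat" where
  "Q_fund_invariant = mat 4 1 (\<lambda>(i, j). [0, 1, \<i>, 0] ! i)"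

lemma sum_atLeast0LessThan_4: "(\<Sum>k = 0..<4. f k) = f 0 + f 1 + f 2 + f (3 :: nat)"
  by (simp add: numeral_eq_Suc)

text \<open>Under E, \<open>v\<^sub>0 \<otimes> v\<^sub>1\<close> goes to
  \<open>v\<^sub>0 \<otimes> v\<^sub>0\<close> and \<open>v\<^sub>1 \<otimes> v\<^sub>0\<close> to
  \<open>\<i>\<close> times it, so the coefficient \<open>\<i>\<close> makes the sum vanish. F is
  similar, and K acts by \<open>\<i> * (- \<i>) = 1\<close>.\<close>

lemma Q_fund_invariant_intertwiner:
  "Q_fund_invariant \<in> intertwiners (unit_rep Q_counit) (tensor_rep Q_comult Q_fund Q_fund)"
proof (rule Q_intertwinersI)
  note [simp] = is_matrep_Q_fund
  show "is_matrep (tensor_rep Q_comult Q_fund Q_fund)"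
    by (simp add: is_matrep_tensor_rep algebra_map_Q_comult)
  show "is_matrep (unit_rep Q_counit)" by (simp add: is_matrep_unit_rep algebra_map_Q_counit)
  show "Q_fund_invariant \<in> carrier_mat (fst (tensor_rep Q_comult Q_fund Q_fund)) (fst (unit_rep Q_counit))"
    by (simp add: Q_fund_invariant_def)
  fix g
  have one: "snd Q_fund 1 = mat_of_mat2 (Mat2 1 0 0 1)"
    by (auto intro!: eq_matI simp: is_matrepD[OF is_matrep_Q_fund])
  show "Q_fund_invariant * snd (unit_rep Q_counit) (Q_gen g) = snd (tensor_rep Q_comult Q_fund Q_fund) (Q_gen g) * Q_fund_invariant"
  proof (rule eq_matI)
    fix i j
    assume "i < dim_row (snd (tensor_rep Q_comult Q_fund Q_fund) (Q_gen g) * Q_fund_invariant)"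
      "j < dim_col (snd (tensor_rep Q_comult Q_fund Q_fund) (Q_gen g) * Q_fund_invariant)"
    then have "i < 4" and j: "j = 0"
      by (auto simp: tensor_rep_def outer_rep_def Q_fund_invariant_def)
    then have "i = 0 \<or> i = 1 \<or> i = 2 \<or> i = 3" by auto
    then show "(Q_fund_invariant * snd (unit_rep Q_counit) (Q_gen g)) $$ (i, j) =
      (snd (tensor_rep Q_comult Q_fund Q_fund) (Q_gen g) * Q_fund_invariant) $$ (i, j)"
      using j
      by (cases g)
        (elim disjE; simp add: tensor_rep_def Q_comult_gen outer_rep_linear one Q_fund_gen
          Q_fund_invariant_def unit_rep_def Q_counit_gen scalar_prod_def sum_atLeast0LessThan_4 kron_index)+
  qed (auto simp: tensor_rep_def outer_rep_def Q_fund_invariant_def unit_rep_def)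
qed

text \<open>The contradiction shared by both halves of the theorem, stated for a bare matrix so that
  it applies to a braiding as well as to the action of a slice of R.\<close>

lemma Q_fund_no_half_braiding:
  assumes U: "U \<in> carrier_mat 2 2" and anti: "U * snd Q_fund Q_E = - snd Q_fund Q_E * U"
    and sq: "U * U = 1\<^sub>m 2" and fixed: "kron U U * Q_fund_invariant = Q_fund_invariant"
  shows False
proof -
  have "(U * snd Q_fund Q_E) $$ (i, j) = (- snd Q_fund Q_E * U) $$ (i, j)" for i j
    by (simp add: anti)
  \<comment> \<open>With E acting as a matrix unit, row 0 of the left side is
    \<open>(0, U $$ (0, 0))\<close> and that of the right side is
    \<open>(- U $$ (1, 0), - U $$ (1, 1))\<close>.\<close>
  from this[of 0 0] this[of 0 1] have 1: "U $$ (1, 0) = 0" "U $$ (0, 0) = - U $$ (1, 1)"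
    using U by (auto simp: Q_fund_gen scalar_prod_def numeral_2_eq_2)
  have "(U * U) $$ (1, 1) = 1" by (simp add: sq)
  then have 2: "U $$ (1, 1) * U $$ (1, 1) = 1"
    using U 1 by (auto simp: scalar_prod_def numeral_2_eq_2)
  \<comment> \<open>Row 1 is the \<open>v\<^sub>0 \<otimes> v\<^sub>1\<close> coordinate. As
    \<open>U\<close> is upper triangular, the left side is also
    \<open>U $$ (0, 0) * U $$ (1, 1) = - 1\<close>.\<close>
  have "(kron U U * Q_fund_invariant) $$ (1, 0) = 1" by (simp add: fixed) (simp add: Q_fund_invariant_def)
  then show False
    using U 1 2 by (auto simp: Q_fund_invariant_def scalar_prod_def sum_atLeast0LessThan_4 kron_index)
qed


section \<open>The universal R-matrix\<close>

text \<open>Each claim slices one R-matrix axiom. For u = (\<chi> \<otimes> id)(R), the axiom for id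
  \<otimes> \<Delta> makes u group-like, and the one for \<Delta> \<otimes> id turns convolution of
  characters into multiplication of slices.\<close>

lemma R_matrix_slice:
  fixes \<chi> \<psi> :: "'a::complex_algebra \<Rightarrow> complex"
  assumes R: "universal_R_matrix \<Delta> R" and \<Delta>: "algebra_map \<Delta>"
    and \<chi>: "algebra_map \<chi>" and \<psi>: "algebra_map \<psi>"
  shows "tensor_lift (\<lambda>a b. \<chi> a *\<^sub>C b) R * tensor_lift (\<lambda>a b. \<chi> a *\<^sub>C b) (\<Delta> x) =
      tensor_lift (\<lambda>a b. \<chi> a *\<^sub>C b) (tensor_flip (\<Delta> x)) * tensor_lift (\<lambda>a b. \<chi> a *\<^sub>C b) R"
    and "\<Delta> (tensor_lift (\<lambda>a b. \<chi> a *\<^sub>C b) R) =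
      tensor_lift (\<lambda>a b. \<chi> a *\<^sub>C b) R \<otimes>\<^sub>t tensor_lift (\<lambda>a b. \<chi> a *\<^sub>C b) R"
    and "tensor_lift (\<lambda>a b. \<chi> a *\<^sub>C b) R * tensor_lift (\<lambda>a b. \<psi> a *\<^sub>C b) R =
      tensor_lift (\<lambda>a b. \<psi> (tensor_lift (\<lambda>a b. \<chi> a *\<^sub>C b) (\<Delta> a)) *\<^sub>C b) R"
proof -
  note l = left_slice
  let ?l = "\<lambda>\<chi>. tensor_lift (\<lambda>a b. \<chi> a *\<^sub>C b)"
  \<comment> \<open>\<open>?L\<close> evaluates \<chi> on the first of three factors; a following
    \<open>?l \<psi>\<close> evaluates \<psi> on the second.\<close>
  let ?L = "tensor_lift (\<lambda>a t. \<chi> a *\<^sub>C t) :: ('a, ('a, 'a) tensor) tensor \<Rightarrow> _"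
  note D = algebra_mapD[OF \<Delta>]
  have b12: "bilinear_map (\<lambda>a b. a \<otimes>\<^sub>t b \<otimes>\<^sub>t (1 :: 'a))"
    and b13: "bilinear_map (\<lambda>a b. a \<otimes>\<^sub>t (1 :: 'a) \<otimes>\<^sub>t b)"
    and b23: "bilinear_map (\<lambda>a b. (1 :: 'a) \<otimes>\<^sub>t a \<otimes>\<^sub>t b)" for a b :: 'a
    by (rule bilinear_mapI; simp add: tens_add_left tens_add_right scaleC_tens_left[symmetric]
        scaleC_tens_right[symmetric])+
  note b = tensor_lift_tens[OF b12] tensor_lift_tens[OF b13] tensor_lift_tens[OF b23]
    tensor_lift_add[OF b12] tensor_lift_add[OF b13] tensor_lift_add[OF b23]
    tensor_lift_zero[OF b12] tensor_lift_zero[OF b13] tensor_lift_zero[OF b23]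
  have "?l \<chi> (R * \<Delta> x) = ?l \<chi> (tensor_flip (\<Delta> x) * R)"
    using R by (simp add: universal_R_matrix_def)
  then show "?l \<chi> R * ?l \<chi> (\<Delta> x) = ?l \<chi> (tensor_flip (\<Delta> x)) * ?l \<chi> R"
    by (simp add: l[OF \<chi>])
  have "?L (tensor_map id \<Delta> R) = ?L (tensor_13 R * tensor_12 R)"
    using R by (simp add: universal_R_matrix_def)
  moreover have "?L (tensor_map id \<Delta> t) = \<Delta> (?l \<chi> t)" for t
    by (induction t rule: tensor_induct)
      (simp_all add: l[OF \<chi>] D clinear_mapD[OF clinear_tensor_map[OF clinear_id(1) D(8)]]
        clinear_mapD[OF clinear_tensor_map[OF clinear_id(2) D(8)]])
  moreover have "?L (tensor_13 t) = 1 \<otimes>\<^sub>t ?l \<chi> t" "?L (tensor_12 t) = ?l \<chi> t \<otimes>\<^sub>t 1" for t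
    unfolding tensor_13_def tensor_12_def
    by (induction t rule: tensor_induct)
      (simp_all add: b l[OF \<chi>] tens_add_left tens_add_right scaleC_tens_left[symmetric]
        scaleC_tens_right[symmetric])
  ultimately show "\<Delta> (?l \<chi> R) = ?l \<chi> R \<otimes>\<^sub>t ?l \<chi> R"
    by (simp add: l[OF \<chi>] tens_mult)
  \<comment> \<open>The convolution product of \<chi> and \<psi>.\<close>
  let ?\<omega> = "\<lambda>x. \<psi> (?l \<chi> (\<Delta> x))"
  have \<omega>: "algebra_map ?\<omega>"
    by (intro algebra_map_comp[OF \<psi>] algebra_map_slice_comult \<chi> \<Delta>)
  have "?l \<psi> (?L (tensor_assoc (tensor_map \<Delta> id R))) = ?l \<psi> (?L (tensor_13 R * tensor_23 R))"
    using R by (simp add: universal_R_matrix_def)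
  \<comment> \<open>Arbitrary \<open>s\<close> allows an induction; the case used next is
    \<open>s = \<Delta> a\<close>.\<close>
  moreover have "?l \<psi> (?L (tensor_assoc (s \<otimes>\<^sub>t c))) = \<psi> (?l \<chi> s) *\<^sub>C c" for s and c :: 'a
    by (induction s rule: tensor_induct)
      (simp_all add: l[OF \<chi>] l[OF \<psi>] tens_add_left clinear_mapD[OF clinear_tensor_assoc]
        algebra_mapD[OF \<psi>] scaleC_add_left scaleC_tens_left scaleC_complex_def)
  then have "?l \<psi> (?L (tensor_assoc (tensor_map \<Delta> id t))) = ?l ?\<omega> t" for t
    by (induction t rule: tensor_induct)
      (simp_all add: l[OF \<chi>] l[OF \<psi>] l[OF \<omega>] D clinear_mapD[OF clinear_tensor_assoc]
        clinear_mapD[OF clinear_tensor_map[OF D(8) clinear_id(2)]])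
  moreover have "?l \<psi> (?L (tensor_13 t)) = ?l \<chi> t" "?l \<psi> (?L (tensor_23 t)) = ?l \<psi> t" for t
    unfolding tensor_13_def tensor_23_def
    by (induction t rule: tensor_induct)
      (simp_all add: b l[OF \<chi>] l[OF \<psi>] algebra_mapD[OF \<chi>] algebra_mapD[OF \<psi>] scaleC_tens_right)
  ultimately show "?l \<chi> R * ?l \<psi> R = ?l ?\<omega> R"
    by (simp add: l[OF \<chi>] l[OF \<psi>])
qed

lemma Q_left_counit: "tensor_lift (\<lambda>a b. Q_counit a *\<^sub>C b) (Q_comult x) = x"
  and Q_right_counit: "tensor_lift (\<lambda>a b. Q_counit b *\<^sub>C a) (Q_comult x) = x"
  using hopf_algebra_Q by (auto simp: hopf_algebra_def)

lemma no_universal_R_matrix_Q: "\<not> universal_R_matrix Q_comult R"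
proof
  assume R: "universal_R_matrix Q_comult R"
  note slice = R_matrix_slice[OF R algebra_map_Q_comult]
  note s = algebra_map_Q_sign and e = algebra_map_Q_counit
  define u where "u = tensor_lift (\<lambda>a b. Q_sign a *\<^sub>C b) R"
  define v where "v = tensor_lift (\<lambda>a b. Q_counit a *\<^sub>C b) R"
  obtain R' where "R * R' = 1" using R by (auto simp: universal_R_matrix_def)
  then have "tensor_lift (\<lambda>a b. Q_counit a *\<^sub>C b) (R * R') = 1"
    by (simp add: left_slice[OF e])
  then obtain v' where v': "v * v' = 1" by (auto simp: v_def left_slice[OF e])
  \<comment> \<open>The counit is idempotent under convolution; the invertible idempotent
    \<open>v\<close> is then 1.\<close>
  have "v * v = v" using slice(3)[OF e e] by (simp add: v_def Q_left_counit)
  then have "v = 1" using v' by (metis mult.assoc mult_1_right)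
  then have uu: "u * u = 1" using slice(3)[OF s s] by (simp add: v_def u_def Q_sign_comult)
  have gl: "Q_comult u = u \<otimes>\<^sub>t u" using slice(2)[OF s s] by (simp add: u_def)
  \<comment> \<open>Slicing 1 \<otimes> E + E \<otimes> K gives E, while slicing its flip gives
    \<chi>(K) E = -E.\<close>
  have uE: "u * Q_E = - Q_E * u"
    using slice(1)[OF s s, of Q_E]
    by (simp add: Q_comult_gen left_slice[OF s] clinear_mapD[OF clinear_tensor_flip]
        Q_sign_gen scaleC_minus_left algebra_mapD[OF s] u_def)
  \<comment> \<open>The counit of \<open>u\<close> is its action on the trivial module; its value 1
    makes the invariant vector a fixed vector.\<close>
  have "Q_counit u *\<^sub>C u = u" using Q_left_counit[of u] by (simp add: gl left_slice[OF e])
  then have "Q_counit u * Q_counit u = Q_counit u"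
    using algebra_mapD(2)[OF e, of "Q_counit u" u] by (simp add: scaleC_complex_def)
  moreover have "Q_counit u * Q_counit u = 1"
    using uu algebra_mapD(6,7)[OF e] by metis
  ultimately have eu: "Q_counit u = 1" by simp
  note X = is_matrepD[OF is_matrep_Q_fund]
  show False
  proof (rule Q_fund_no_half_braiding)
    show "snd Q_fund u \<in> carrier_mat 2 2" using X(1)[of u] by simp
    have "snd Q_fund (- Q_E) = - snd Q_fund Q_E"
      using X(3)[of "- 1" Q_E] by (auto intro!: eq_matI simp: scaleC_minus_left X)
    then show "snd Q_fund u * snd Q_fund Q_E = - snd Q_fund Q_E * snd Q_fund u"
      using X(5)[of u Q_E] X(5)[of "- Q_E" u] uE by simp
    show "snd Q_fund u * snd Q_fund u = 1\<^sub>m 2" using X(5)[of u u] X(4) uu by simp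
    have "Q_fund_invariant * snd (unit_rep Q_counit) u = snd (tensor_rep Q_comult Q_fund Q_fund) u * Q_fund_invariant"
      using Q_fund_invariant_intertwiner by (simp add: intertwiners_def)
    moreover have "Q_fund_invariant * snd (unit_rep Q_counit) u = Q_fund_invariant"
      by (rule eq_matI) (auto simp: unit_rep_def eu Q_fund_invariant_def scalar_prod_def)
    ultimately show "kron (snd Q_fund u) (snd Q_fund u) * Q_fund_invariant = Q_fund_invariant"
      by (simp add: tensor_rep_def gl is_matrep_Q_fund)
  qed
qed


section \<open>Braidings\<close>

text \<open>Serves to show that braidings with the unit object are identities, since a hexagon makes
  them idempotent.\<close>

lemma idempotent_invertible_mat:
  fixes A :: "complex mat"
  assumes "A \<in> carrier_mat n n" "B \<in> carrier_mat n n" "A * A = A" "B * A = 1\<^sub>m n"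
  shows "A = 1\<^sub>m n"
proof -
  have "A = (B * A) * A" using assms by simp
  also have "\<dots> = B * (A * A)" using assms assoc_mult_mat by blast
  finally show ?thesis using assms by simp
qed

text \<open>The braiding axioms as matrix identities; associators are identity matrices and drop out
  of the hexagons.\<close>

lemma braiding_rep_categoryD:
  assumes c: "braiding (rep_category \<Delta> \<epsilon>) c" and U: "is_matrep U" and V: "is_matrep V" and W: "is_matrep W"
    and \<Delta>: "algebra_map \<Delta>"
  shows "c U V \<in> intertwiners (tensor_rep \<Delta> U V) (tensor_rep \<Delta> V U)"
    and "\<exists>d\<in>carrier_mat (fst U * fst V) (fst U * fst V). d * c U V = 1\<^sub>m (fst U * fst V)"
    and "is_matrep V' \<Longrightarrow> g \<in> intertwiners V V' \<Longrightarrow> c U V' * kron (1\<^sub>m (fst U)) g = kron g (1\<^sub>m (fst U)) * c U V"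
    and "c U (tensor_rep \<Delta> V W) = kron (1\<^sub>m (fst V)) (c U W) * kron (c U V) (1\<^sub>m (fst W))"
    and "c (tensor_rep \<Delta> U V) W = kron (c U W) (1\<^sub>m (fst V)) * kron (1\<^sub>m (fst U)) (c V W)"
proof -
  let ?C = "rep_category \<Delta> \<epsilon>"
  have c_iso: "iso_mor ?C (tensor_rep \<Delta> X Y) (tensor_rep \<Delta> Y X) (c X Y)"
    if "is_matrep X" "is_matrep Y" for X Y
    using c that by (simp add: braiding_def rep_category_def del: split_paired_All split_paired_Ex)
  then have ci: "c X Y \<in> intertwiners (tensor_rep \<Delta> X Y) (tensor_rep \<Delta> Y X)"
    if "is_matrep X" "is_matrep Y" for X Y
    using that by (simp add: iso_mor_def rep_category_def)
  then have cc: "c X Y \<in> carrier_mat (fst Y * fst X) (fst X * fst Y)"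
    if "is_matrep X" "is_matrep Y" for X Y
    using ci[OF that] by (simp add: intertwiners_def)
  show "c U V \<in> intertwiners (tensor_rep \<Delta> U V) (tensor_rep \<Delta> V U)" using ci U V .
  show "\<exists>d\<in>carrier_mat (fst U * fst V) (fst U * fst V). d * c U V = 1\<^sub>m (fst U * fst V)"
    using c_iso[OF U V] by (auto simp: iso_mor_def rep_category_def intertwiners_def mult.commute)
  have "1\<^sub>m (fst U) \<in> intertwiners U U"
    using left_mult_one_mat[OF is_matrepD(1)[OF U]] right_mult_one_mat[OF is_matrepD(1)[OF U]]
    by (simp add: intertwiners_def)
  then show "c U V' * kron (1\<^sub>m (fst U)) g = kron g (1\<^sub>m (fst U)) * c U V"
    if "is_matrep V'" "g \<in> intertwiners V V'"
    using c that U V by (simp add: braiding_def rep_category_def del: split_paired_All split_paired_Ex)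
  have "1\<^sub>m (fst V * fst W * fst U) * (c U (tensor_rep \<Delta> V W) * 1\<^sub>m (fst U * fst V * fst W)) =
    kron (1\<^sub>m (fst V)) (c U W) * (1\<^sub>m (fst V * fst U * fst W) * kron (c U V) (1\<^sub>m (fst W)))"
    using c U V W by (simp add: braiding_def rep_category_def del: split_paired_All split_paired_Ex)
  moreover have "c U (tensor_rep \<Delta> V W) \<in> carrier_mat (fst V * fst W * fst U) (fst U * fst V * fst W)"
    using cc[OF U is_matrep_tensor_rep[OF \<Delta> V W]] by (simp add: mult.assoc)
  moreover have "kron (c U V) (1\<^sub>m (fst W)) \<in> carrier_mat (fst V * fst U * fst W) (fst U * fst V * fst W)"
    using cc[OF U V] by simp
  ultimately show "c U (tensor_rep \<Delta> V W) = kron (1\<^sub>m (fst V)) (c U W) * kron (c U V) (1\<^sub>m (fst W))"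
    by (metis left_mult_one_mat right_mult_one_mat)
  have "1\<^sub>m (fst W * fst U * fst V) * (c (tensor_rep \<Delta> U V) W * 1\<^sub>m (fst U * fst V * fst W)) =
    kron (c U W) (1\<^sub>m (fst V)) * (1\<^sub>m (fst U * fst W * fst V) * kron (1\<^sub>m (fst U)) (c V W))"
    using c U V W by (simp add: braiding_def rep_category_def del: split_paired_All split_paired_Ex)
  moreover have "c (tensor_rep \<Delta> U V) W \<in> carrier_mat (fst W * fst U * fst V) (fst U * fst V * fst W)"
    using cc[OF is_matrep_tensor_rep[OF \<Delta> U V] W] by (simp add: mult.assoc)
  moreover have "kron (1\<^sub>m (fst U)) (c V W) \<in> carrier_mat (fst U * fst W * fst V) (fst U * fst V * fst W)"
    using kron_carrier[OF one_carrier_mat cc[OF V W]] by (simp add: mult.assoc)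
  ultimately show "c (tensor_rep \<Delta> U V) W = kron (c U W) (1\<^sub>m (fst V)) * kron (1\<^sub>m (fst U)) (c V W)"
    by (metis left_mult_one_mat right_mult_one_mat)
qed

lemma not_braidable_Q: "\<not> braidable (rep_category Q_comult Q_counit)"
proof
  assume "braidable (rep_category Q_comult Q_counit)"
  then obtain c where c: "braiding (rep_category Q_comult Q_counit) c" by (auto simp: braidable_def)
  let ?I = "unit_rep Q_counit" and ?N = "unit_rep Q_sign" and ?X = "Q_fund"
  have I: "is_matrep ?I" and N: "is_matrep ?N" and X: "is_matrep ?X"
    by (simp_all add: is_matrep_unit_rep algebra_map_Q_counit algebra_map_Q_sign is_matrep_Q_fund)
  note br = braiding_rep_categoryD[OF c _ _ _ algebra_map_Q_comult]
  define U where "U = c ?N ?X"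
  have II: "tensor_rep Q_comult ?I ?I = ?I"
    using tensor_rep_character_left[OF algebra_map_Q_counit I] by (simp add: Q_left_counit)
  have NN: "tensor_rep Q_comult ?N ?N = ?I"
    using tensor_rep_character_left[OF algebra_map_Q_sign N]
    by (simp add: unit_rep_def pullback_rep_def Q_sign_comult)
  have IX: "tensor_rep Q_comult ?I ?X = ?X" "tensor_rep Q_comult ?X ?I = ?X"
    using tensor_rep_character_left[OF algebra_map_Q_counit X]
      tensor_rep_character_right[OF algebra_map_Q_counit X]
    by (simp_all add: Q_left_counit Q_right_counit)
  have car: "c V W \<in> carrier_mat (fst W * fst V) (fst V * fst W)" if "is_matrep V" "is_matrep W" for V W
    using br(1)[OF that that(2)] by (simp add: intertwiners_def)
  \<comment> \<open>As the unit object equals its tensor square, a hexagon gives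
    \<open>c ?I ?X = c ?I ?X * c ?I ?X\<close>.\<close>
  have cIX: "c ?I ?X = 1\<^sub>m 2"
    using br(5)[OF I I X] br(2)[OF I X X] car[OF I X] idempotent_invertible_mat
    by (auto simp: II simp del: One_nat_def)
  have cNI: "c ?N ?I = 1\<^sub>m 1"
    using br(4)[OF N I I] br(2)[OF N I I] car[OF N I] idempotent_invertible_mat
    by (auto simp: II simp del: One_nat_def)
  show False
  proof (rule Q_fund_no_half_braiding)
    show U: "U \<in> carrier_mat 2 2" using car[OF N X] by (simp add: U_def)
    \<comment> \<open>The coproduct of E is 1 \<otimes> E + E \<otimes> K. The character kills E and
      sends K to -1, so E acts by E when the character is on the left and by -E when it is on the
      right.\<close>
    have "U * snd (tensor_rep Q_comult ?N ?X) Q_E = snd (tensor_rep Q_comult ?X ?N) Q_E * U"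
      using br(1)[OF N X X] by (simp add: intertwiners_def U_def)
    moreover have "snd (tensor_rep Q_comult ?N ?X) Q_E = snd ?X Q_E"
      by (simp add: tensor_rep_character_left algebra_map_Q_sign X Q_comult_gen Q_sign_gen
          left_slice[OF algebra_map_Q_sign] algebra_mapD[OF algebra_map_Q_sign])
    moreover have "snd (tensor_rep Q_comult ?X ?N) Q_E = - snd ?X Q_E"
    proof -
      note b = bilinear_scale_right[OF algebra_mapD(8)[OF algebra_map_Q_sign]]
      have "snd (tensor_rep Q_comult ?X ?N) Q_E = snd ?X ((- 1) *\<^sub>C Q_E)"
        by (simp add: tensor_rep_character_right algebra_map_Q_sign X Q_comult_gen Q_sign_gen b
            algebra_mapD[OF algebra_map_Q_sign])
      also have "\<dots> = - snd ?X Q_E"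
        unfolding is_matrepD(3)[OF X] by (auto intro!: eq_matI simp: is_matrepD[OF X])
      finally show ?thesis .
    qed
    ultimately show "U * snd ?X Q_E = - snd ?X Q_E * U" by simp
    show "U * U = 1\<^sub>m 2"
      using br(5)[OF N N X] by (simp add: NN cIX U_def del: One_nat_def)
    \<comment> \<open>Naturality in the second argument along the invariant vector, seen as a map
      from the unit object.\<close>
    have "c ?N (tensor_rep Q_comult ?X ?X) * Q_fund_invariant = Q_fund_invariant * c ?N ?I"
      using br(3)[OF N I I is_matrep_tensor_rep[OF algebra_map_Q_comult X X] Q_fund_invariant_intertwiner]
      by (simp del: One_nat_def)
    moreover have "c ?N (tensor_rep Q_comult ?X ?X) = kron U U"
      using br(4)[OF N X X] kron_mult[OF one_carrier_mat U U one_carrier_mat] U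
      by (simp add: U_def)
    moreover have "Q_fund_invariant \<in> carrier_mat 4 1" by (simp add: Q_fund_invariant_def)
    ultimately show "kron U U * Q_fund_invariant = Q_fund_invariant" by (simp add: cNI del: One_nat_def)
  qed
qed

theorem theorem1p1:
  shows "\<not> braidable (rep_category Q_comult Q_counit) \<and>
         \<not> (\<exists>R. universal_R_matrix Q_comult R)"
  using not_braidable_Q no_universal_R_matrix_Q by blast

end
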